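(* Let $n\ge1$ and let $R\subset V$ be a GRRS with $cl(R)=BC_n$, $k=\dim\mathrm{Ker}(-,-)$. Then, up to isomorphism, $R$ has the form $$R=\{\pm\varepsilon_i+H_1\}_{1\le i\le n}\cup\{\pm2\varepsilon_i+H_2\}_{1\le i\le n}\cup\{\pm\varepsilon_i\pm\varepsilon_j+H_3\}_{1\le i<j\le n}$$ (the last family being absent for $n=1$), with $H_1,H_2,H_3\subset\mathrm{Ker}(-,-)$, $H_i=-H_i$, $0\in H_1$, $0\in H_3$, as follows. (a) If $n=1$: let $L:=\mathbb{Z}R\cap\mathrm{Ker}(-,-)$, a free abelian group of rank $k$, and let $\iota_2:L\to L/2L\cong\mathbb{F}_2^k$ be the canonical map. Then $H_1=\iota_2^{-1}(S)$ for some $S\subset\mathbb{F}_2^k$ containing zero and a basis of $\mathbb{F}_2^k$, and $H_2\subset\iota_2^{-1}(S)$ satisfies $H_2+4L\subset H_2$ and $H_2+2H_2\subset H_2$. (b) If $n>2$: $L:=\mathbb{Z}H_3$ is a free abelian group of rank $k$, $H_3=L$, and there are subsets $S_1,S_2\subset\mathbb{F}_2^k$ with $0\in S_1$ such that $H_1\subset\frac12L$ is the preimage of $S_1$ under $\frac12L\to\frac12L/L\cong\mathbb{F}_2^k$ and $H_2\subset L$ is the preimage of $S_2$ under $L\to L/2L\cong\mathbb{F}_2^k$. (c) If $n=2$: $L:=\mathbb{Z}H_3$ is a free abelian group of rank $k$, there are $S_1,S_2\subset\mathbb{F}_2^k$ with $0\in S_1$ such that $H_1\subset\frac12L$ and $H_2\subset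 L$ are the preimages of $S_1,S_2$ as in (b), and $H_3\subset L$ contains $0$ and a basis of $L$ and satisfies $H_2+H_3=2H_1+H_3\subset H_3$.
   Context: **GRRS.** $V$ is a finite-dimensional complex space with symmetric bilinear form $(-,-)$, $\mathrm{Ker}(-,-)=\{v:\ (v,w)=0\ \forall w\in V\}$. For $(\alpha,\alpha)\ne0$, $r_\alpha(v):=v-\frac{2(\alpha,v)}{(\alpha,\alpha)}\alpha$. A non-empty $R\subset V$ is a GRRS if: (GR0) $\mathrm{Ker}(-,-)\cap R=\emptyset$; (GR1) $\mathbb{Z}R\otimes_{\mathbb{Z}}\mathbb{C}\to V$ is a bijection; (GR2) for $\alpha\in R$ with $(\alpha,\alpha)\neq 0$, $r_\alpha R=R$ and $\beta-r_\alpha\beta\in\mathbb{Z}\alpha$ for all $\beta\in R$; (GR3) for each $\alpha\in R$ with $(\alpha,\alpha)=0$ there is an invertible map $r_\alpha:R\to R$ with $r_\alpha(\pm\alpha)=\mp\alpha$, $r_\alpha(\beta)=\beta$ if $\beta\neq\pm\alpha$, $(\alpha,\beta)=0$, and $r_\alpha(\beta)\in\{\beta\pm\alpha\}$ if $(\alpha,\beta)\ne0$. $R\subset V$, $R'\subset V'$ are isomorphic if there are a linear isomorphism $\iota:V\to V'$ and $c\in\mathbb{C}^*$ with $(\iota v,\iota w)=c(v,w)$ for all $v,w$ and $\iota(R)=R'$. $cl(R)$ is the image of $R$ in $V/\mathrm{Ker}(-,-)$, and "$cl(R)=BC_n$" means equality up to such an isomorphism, where $BC_n=\{\pm\varepsilon_i,\pm2\varepsilon_i\}_{1\le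 i\le n}\cup\{\pm\varepsilon_i\pm\varepsilon_j\}_{1\le i<j\le n}$ with $\varepsilon_1,\dots,\varepsilon_n$ orthonormal. In the claim, $V$ is identified with the orthogonal sum of $\mathrm{span}(\varepsilon_1,\dots,\varepsilon_n)$ and $\mathrm{Ker}(-,-)$; $\alpha+H$ denotes all $\alpha+v$, $v\in H$; $\mathbb{Z}X$ is the additive group generated by $X$; for sets $A,B$, $A+B=\{a+b\}$ and $cA=\{ca\}$.
   Formalization: The theorem adds that ZR is finitely generated. As stated the claim fails: V=C^2 with form xx', R={±1,±2}×Q satisfies (GR0)-(GR3) with cl(R)=BC_1, but L=Q is not free. The claimed conclusion itself forces ZR to be finitely generated. *)

theory Defs
  imports
    "HOL-Analysis.Analysis"
    "HOL-Library.Set_Algebras"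
    "HOL-Library.Function_Algebras"
    "HOL-Library.Poly_Mapping"
    "HOL-Library.Z2"
    "HOL-Computational_Algebra.Group_Closure"
begin

text \<open>
  A complex vector space is a type \<open>'v\<close> with a scalar multiplication \<open>s\<close>.  The library constant
  \<^const>\<open>group_closure\<close> is the additive group generated by a set (written $\mathbb{Z}X$ in
  the literature), and \<open>A + B\<close>, \<open>v +o A\<close> on sets are those of \<^theory>\<open>HOL-Library.Set_Algebras\<close>.
\<close>

definition form_space ::
    "(complex \<Rightarrow> 'v \<Rightarrow> 'v::ab_group_add) \<Rightarrow> ('v \<Rightarrow> 'v \<Rightarrow> complex) \<Rightarrow> bool" where
  "form_space s B \<longleftrightarrow>
     (\<exists>Basis. finite_dimensional_vector_space s Basis) \<and>
     (\<forall>u. Vector_Spaces.linear s (*) (B u)) \<and> (\<forall>u v. B u v = B v u)"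

definition form_ker :: "('v \<Rightarrow> 'v \<Rightarrow> complex) \<Rightarrow> 'v set" where
  "form_ker B = {v. \<forall>w. B v w = 0}"

definition reflection ::
    "(complex \<Rightarrow> 'v \<Rightarrow> 'v::ab_group_add) \<Rightarrow> ('v \<Rightarrow> 'v \<Rightarrow> complex) \<Rightarrow> 'v \<Rightarrow> 'v \<Rightarrow> 'v" where
  "reflection s B \<alpha> v = v - s (2 * B \<alpha> v / B \<alpha> \<alpha>) \<alpha>"


subsection \<open>The tensor product of an additive subgroup with the complex numbers\<close>

text \<open>
  For a subgroup \<open>M\<close>, the tensor product over the integers is the free abelian group on the pairs
  \<open>(x, c)\<close> with \<open>x \<in> M\<close>, modulo the subgroup generated by the biadditivity relations.
\<close>

definition tensor_free :: "'v set \<Rightarrow> ('v \<times> complex \<Rightarrow>\<^sub>0 int) set" where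
  "tensor_free M = {t. Poly_Mapping.keys t \<subseteq> M \<times> UNIV}"

definition tensor_rels :: "'v::ab_group_add set \<Rightarrow> ('v \<times> complex \<Rightarrow>\<^sub>0 int) set" where
  "tensor_rels M = group_closure
     ({frag_of (x + y, c) - frag_of (x, c) - frag_of (y, c) | x y c. x \<in> M \<and> y \<in> M} \<union>
      {frag_of (x, c + d) - frag_of (x, c) - frag_of (x, d) | x c d. x \<in> M})"

definition tensor_complex :: "'v::ab_group_add set \<Rightarrow> ('v \<times> complex \<Rightarrow>\<^sub>0 int) set set" where
  "tensor_complex M =
     tensor_free M // {(t, u). t \<in> tensor_free M \<and> u \<in> tensor_free M \<and> t - u \<in> tensor_rels M}"

definition tensor_eval ::
    "(complex \<Rightarrow> 'v \<Rightarrow> 'v::ab_group_add) \<Rightarrow> ('v \<times> complex \<Rightarrow>\<^sub>0 int) \<Rightarrow> 'v" where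
  "tensor_eval s t =
     (\<Sum>(x, c) \<in> Poly_Mapping.keys t. s (of_int (Poly_Mapping.lookup t (x, c)) * c) x)"

text \<open>
  The canonical map sending the class of \<open>(x, c)\<close> to \<open>s c x\<close>; \<^const>\<open>tensor_eval\<close> is constant on
  each class, so the image of a class is a singleton.
\<close>

definition tensor_map ::
    "(complex \<Rightarrow> 'v \<Rightarrow> 'v::ab_group_add) \<Rightarrow> ('v \<times> complex \<Rightarrow>\<^sub>0 int) set \<Rightarrow> 'v" where
  "tensor_map s X = the_elem (tensor_eval s ` X)"


subsection \<open>Generalized reflection root systems\<close>

definition GRRS ::
    "(complex \<Rightarrow> 'v \<Rightarrow> 'v::ab_group_add) \<Rightarrow> ('v \<Rightarrow> 'v \<Rightarrow> complex) \<Rightarrow> 'v set \<Rightarrow> bool" where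
  "GRRS s B R \<longleftrightarrow>
     form_space s B \<and> R \<noteq> {} \<and>
     form_ker B \<inter> R = {} \<and>
     bij_betw (tensor_map s) (tensor_complex (group_closure R)) UNIV \<and>
     (\<forall>\<alpha>\<in>R. B \<alpha> \<alpha> \<noteq> 0 \<longrightarrow>
        reflection s B \<alpha> ` R = R \<and>
        (\<forall>\<beta>\<in>R. \<beta> - reflection s B \<alpha> \<beta> \<in> group_closure {\<alpha>})) \<and>
     (\<forall>\<alpha>\<in>R. B \<alpha> \<alpha> = 0 \<longrightarrow>
        (\<exists>r. bij_betw r R R \<and> r \<alpha> = - \<alpha> \<and> r (- \<alpha>) = \<alpha> \<and>
           (\<forall>\<beta>\<in>R. \<beta> \<noteq> \<alpha> \<and> \<beta> \<noteq> - \<alpha> \<and> B \<alpha> \<beta> = 0 \<longrightarrow> r \<beta> = \<beta>) \<and>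
           (\<forall>\<beta>\<in>R. B \<alpha> \<beta> \<noteq> 0 \<longrightarrow> r \<beta> \<in> {\<beta> + \<alpha>, \<beta> - \<alpha>})))"

definition GRRS_iso ::
    "(complex \<Rightarrow> 'v \<Rightarrow> 'v::ab_group_add) \<Rightarrow> ('v \<Rightarrow> 'v \<Rightarrow> complex) \<Rightarrow> 'v set \<Rightarrow>
     (complex \<Rightarrow> 'w \<Rightarrow> 'w::ab_group_add) \<Rightarrow> ('w \<Rightarrow> 'w \<Rightarrow> complex) \<Rightarrow> 'w set \<Rightarrow> bool" where
  "GRRS_iso s B R s' B' R' \<longleftrightarrow>
     (\<exists>\<iota> c. Vector_Spaces.linear s s' \<iota> \<and> bij \<iota> \<and> c \<noteq> 0 \<and>
        (\<forall>v w. B' (\<iota> v) (\<iota> w) = c * B v w) \<and> \<iota> ` R = R')"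

text \<open>
  Elements of the quotient of \<open>V\<close> by the kernel of the form are the cosets \<open>v +o form_ker B\<close>.
  Its vector space structure and its form are induced from representatives, and
  \<open>cl_iso\<close> is the notion of isomorphism above with \<open>cl B R\<close>, inside that quotient, as its source.
\<close>

definition cl :: "('v \<Rightarrow> 'v \<Rightarrow> complex) \<Rightarrow> 'v::ab_group_add set \<Rightarrow> 'v set set" where
  "cl B R = (\<lambda>v. v +o form_ker B) ` R"

definition cl_iso ::
    "(complex \<Rightarrow> 'v \<Rightarrow> 'v::ab_group_add) \<Rightarrow> ('v \<Rightarrow> 'v \<Rightarrow> complex) \<Rightarrow> 'v set \<Rightarrow>
     (complex \<Rightarrow> 'w \<Rightarrow> 'w::ab_group_add) \<Rightarrow> ('w \<Rightarrow> 'w \<Rightarrow> complex) \<Rightarrow> 'w set \<Rightarrow> bool" where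
  "cl_iso s B R s' B' R' \<longleftrightarrow>
     (\<exists>\<iota> c. bij_betw \<iota> (cl B UNIV) UNIV \<and>
        (\<forall>v w. \<iota> ((v + w) +o form_ker B) = \<iota> (v +o form_ker B) + \<iota> (w +o form_ker B)) \<and>
        (\<forall>a v. \<iota> (s a v +o form_ker B) = s' a (\<iota> (v +o form_ker B))) \<and>
        c \<noteq> 0 \<and>
        (\<forall>v w. B' (\<iota> (v +o form_ker B)) (\<iota> (w +o form_ker B)) = c * B v w) \<and>
        \<iota> ` cl B R = R')"


subsection \<open>The root system of type BC\<close>

text \<open>
  The index type \<open>'n\<close> carries no order: as all signs occur, the pairs \<open>i < j\<close> may be replaced by
  the pairs \<open>i \<noteq> j\<close>.
\<close>

definition short_roots :: "('n \<Rightarrow> 'v::ab_group_add) \<Rightarrow> 'v set" where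
  "short_roots \<epsilon> = (\<Union>i. {\<epsilon> i, - \<epsilon> i})"

definition long_roots :: "(complex \<Rightarrow> 'v \<Rightarrow> 'v) \<Rightarrow> ('n \<Rightarrow> 'v::ab_group_add) \<Rightarrow> 'v set" where
  "long_roots s \<epsilon> = (\<Union>i. {s 2 (\<epsilon> i), - s 2 (\<epsilon> i)})"

definition middle_roots :: "('n \<Rightarrow> 'v::ab_group_add) \<Rightarrow> 'v set" where
  "middle_roots \<epsilon> =
     (\<Union>i. \<Union>j\<in>{j. i \<noteq> j}. {\<epsilon> i + \<epsilon> j, \<epsilon> i - \<epsilon> j, - \<epsilon> i + \<epsilon> j, - \<epsilon> i - \<epsilon> j})"

definition std_basis :: "'n \<Rightarrow> complex ^ 'n::finite" where
  "std_basis i = axis i 1"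

text \<open>The bilinear form on \<open>complex ^ 'n\<close>, not the Hermitian one.\<close>

definition std_form :: "complex ^ 'n::finite \<Rightarrow> complex ^ 'n \<Rightarrow> complex" where
  "std_form x y = (\<Sum>i\<in>UNIV. x $ i * y $ i)"

definition BC :: "(complex ^ 'n::finite) set" where
  "BC = short_roots std_basis \<union> long_roots (*s) std_basis \<union> middle_roots std_basis"

definition orthonormal_splitting ::
    "(complex \<Rightarrow> 'v \<Rightarrow> 'v::ab_group_add) \<Rightarrow> ('v \<Rightarrow> 'v \<Rightarrow> complex) \<Rightarrow> ('n \<Rightarrow> 'v) \<Rightarrow> bool" where
  "orthonormal_splitting s B \<epsilon> \<longleftrightarrow>
     (\<forall>i j. B (\<epsilon> i) (\<epsilon> j) = (if i = j then 1 else 0)) \<and>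
     module.span s (range \<epsilon>) + form_ker B = UNIV \<and>
     module.span s (range \<epsilon>) \<inter> form_ker B = {0}"


subsection \<open>Free abelian groups and reduction modulo two\<close>

definition Z_basis ::
    "(complex \<Rightarrow> 'v \<Rightarrow> 'v::ab_group_add) \<Rightarrow> 'v set \<Rightarrow> 'v set \<Rightarrow> bool" where
  "Z_basis s X L \<longleftrightarrow> \<not> module.dependent (\<lambda>m::int. s (of_int m)) X \<and> group_closure X = L"

definition free_of_rank ::
    "(complex \<Rightarrow> 'v \<Rightarrow> 'v::ab_group_add) \<Rightarrow> 'v set \<Rightarrow> nat \<Rightarrow> bool" where
  "free_of_rank s L k \<longleftrightarrow> (\<exists>X. finite X \<and> card X = k \<and> Z_basis s X L)"

definition F2 :: "nat \<Rightarrow> (nat \<Rightarrow> bit) set" where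
  "F2 k = {f. \<forall>i\<ge>k. f i = 0}"

definition F2_basis :: "(nat \<Rightarrow> bit) set \<Rightarrow> nat \<Rightarrow> bool" where
  "F2_basis T k \<longleftrightarrow>
     \<not> module.dependent (\<lambda>(a::bit) f i. a * f i) T \<and>
     module.span (\<lambda>(a::bit) f i. a * f i) T = F2 k"

text \<open>
  \<open>\<phi>\<close> is the projection from \<open>A\<close> to \<open>A/A'\<close> followed by an identification of \<open>A/A'\<close> with \<open>F2 k\<close>,
  that is, a surjective homomorphism from \<open>A\<close> to \<open>F2 k\<close> with kernel \<open>A'\<close>.
\<close>

definition quotient_map_F2 ::
    "'v::ab_group_add set \<Rightarrow> 'v set \<Rightarrow> nat \<Rightarrow> ('v \<Rightarrow> nat \<Rightarrow> bit) \<Rightarrow> bool" where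
  "quotient_map_F2 A A' k \<phi> \<longleftrightarrow>
     \<phi> ` A = F2 k \<and> (\<forall>x\<in>A. \<forall>y\<in>A. \<phi> (x + y) = \<phi> x + \<phi> y) \<and> {x \<in> A. \<phi> x = 0} = A'"

end

theory Submission
  imports Defs
begin

text \<open>
  The tensor condition says that elements of the group generated by \<open>R\<close> which are independent over
  the integers are independent over the complex numbers; hence a subgroup of that group which spans
  the kernel of the form is free of rank \<open>k\<close>.  Lifts of the short roots can be chosen in \<open>R\<close> with all
  their differences in \<open>R\<close>.  The reflections in these generate the Weyl group and fix the kernel
  pointwise, so the set of \<open>h\<close> in the kernel with \<open>\<alpha> + h \<in> R\<close> depends only on the length of \<open>\<alpha>\<close>.  All
  relations between \<open>H1\<close>, \<open>H2\<close> and \<open>H3\<close> are instances of one formula: if \<open>m\<close> is the Cartan integer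
  of \<open>\<beta>\<close> and \<open>\<alpha>\<close>, the reflection in \<open>\<alpha> + h\<close> maps \<open>\<beta> + h'\<close> to \<open>(\<beta> - m\<alpha>) + (h' - mh)\<close>.
\<close>

text \<open>The tensor condition alone does not bound denominators: the group of dyadic rationals
  also becomes one-dimensional when tensored with the complex numbers, yet it is not free and its
  reduction modulo 2 vanishes. Freeness therefore comes from finite generation of the group of
  roots: clearing denominators in a rational basis embeds this group in a free one, whose subgroups
  are free. Injectivity of the tensor map then makes an integral basis of a lattice independent over
  the complex numbers, and surjectivity makes the roots span, which forces the lattice to span the
  kernel; so its rank is \<open>k\<close>. The choice of lifts is a normalisation that puts 0 into
  \<open>H1\<close> and \<open>H3\<close>. Nothing is left to normalise \<open>H2\<close>, which may
  miss 0. The cases differ by the Cartan integers available: 1, 2 or 4 decides whether a shift set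
  is closed under adding \<open>L\<close>, twice \<open>L\<close> or four times
  \<open>L\<close>.\<close>

subsection \<open>Finitely generated torsion-free groups\<close>

text \<open>Over a ring, \<open>x \<notin> span Y\<close> would be too weak, because a nonzero
  multiple of \<open>x\<close> could still lie in \<open>span Y\<close>. Excluding these kills the
  coefficient of \<open>x\<close>; what remains is a relation in \<open>Y\<close>.\<close>

lemma (in module) independent_insertI_torsion_free:
  assumes Y: "independent Y" and x: "\<And>k. scale k x \<in> span Y \<Longrightarrow> k = 0"
  shows "independent (insert x Y)"
  unfolding independent_explicit_module
proof (intro allI impI)
  fix t u v
  assume t: "finite t" "t \<subseteq> insert x Y" "(\<Sum>v\<in>t. scale (u v) v) = 0" "v \<in> t"
  have fin: "finite (t - {x})" and sub: "t - {x} \<subseteq> Y"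
    using t by auto
  have rest: "(\<Sum>v\<in>t - {x}. scale (u v) v) \<in> span Y"
    using sub by (intro span_sum span_scale span_base) auto
  have ux: "u x = 0" if "x \<in> t"
  proof -
    have "scale (u x) x = - (\<Sum>v\<in>t - {x}. scale (u v) v)"
      using t(3) sum.remove[OF t(1) that, of "\<lambda>v. scale (u v) v"] by (simp add: eq_neg_iff_add_eq_0)
    then show ?thesis
      using x span_neg[OF rest] by metis
  qed
  have "(\<Sum>v\<in>t - {x}. scale (u v) v) = 0"
  proof (cases "x \<in> t")
    case True
    then show ?thesis
      using t(3) sum.remove[OF t(1) True, of "\<lambda>v. scale (u v) v"] ux by simp
  next
    case False
    then show ?thesis using t(3) by simp
  qed
  then show "u v = 0"
    using independentD[OF Y fin sub] t(4) ux by (cases "v = x") auto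
qed

lemma (in module) independent_insertD_scale:
  assumes "independent (insert a X)" "a \<notin> X" "scale k a \<in> span X"
  shows "k = 0"
proof -
  obtain t u where t: "finite t" "t \<subseteq> X" "scale k a = (\<Sum>v\<in>t. scale (u v) v)"
    using assms(3) unfolding span_explicit by auto
  define w where "w = u(a := - k)"
  have "(\<Sum>v\<in>insert a t. scale (w v) v) = scale (w a) a + (\<Sum>v\<in>t. scale (w v) v)"
    using t assms(2) by (subst sum.insert) auto
  also have "(\<Sum>v\<in>t. scale (w v) v) = (\<Sum>v\<in>t. scale (u v) v)"
    using t assms(2) by (intro sum.cong) (auto simp: w_def)
  finally have "(\<Sum>v\<in>insert a t. scale (w v) v) = 0"
    using t by (simp add: w_def)
  then have "w a = 0"
    using independentD[OF assms(1), of "insert a t" w a] t by auto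
  then show ?thesis by (simp add: w_def)
qed

text \<open>Used to turn rational relations into integral ones and to fit finitely many vectors into
  one lattice.\<close>

lemma common_denominator:
  assumes "finite A"
  shows "\<exists>N::int. N > 0 \<and> (\<forall>x\<in>A. \<exists>w. of_int N * u x = (of_int w :: rat))"
  using assms
proof induction
  case empty
  then show ?case by (intro exI[of _ 1]) simp
next
  case (insert a A)
  then obtain N where N: "N > 0" "\<forall>x\<in>A. \<exists>w. of_int N * u x = (of_int w :: rat)"
    by blast
  obtain p q where pq: "quotient_of (u a) = (p, q)"
    by fastforce
  then have q: "q > 0" and ua: "u a = of_int p / of_int q"
    using quotient_of_denom_pos quotient_of_div by blast+
  have "of_int (q * N) * u a = (of_int (N * p) :: rat)"
    using q by (simp add: ua)
  moreover have "\<exists>w. of_int (q * N) * u x = (of_int w :: rat)" if x: "x \<in> A" for x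
  proof -
    obtain w where w: "of_int N * u x = (of_int w :: rat)"
      using N x by blast
    have "of_int (q * N) * u x = of_int q * (of_int N * u x)"
      by (simp only: of_int_mult mult.assoc)
    also have "\<dots> = of_int (q * w)"
      by (simp only: w of_int_mult)
    finally show ?thesis by blast
  qed
  ultimately have "\<forall>x\<in>insert a A. \<exists>w. of_int (q * N) * u x = (of_int w :: rat)"
    by blast
  then show ?case
    using N q by (intro exI[of _ "q * N"]) simp
qed

text \<open>With the scalars fixed to be complex, the same vectors also form a module over the
  integers and a vector space over the rationals; the proof moves between the three notions of
  independence.\<close>

locale complex_space = vector_space s for s :: "complex \<Rightarrow> 'v::ab_group_add \<Rightarrow> 'v"
begin

sublocale Z: module "\<lambda>m::int. s (of_int m)"
  by unfold_locales (simp_all add: scale_right_distrib scale_left_distrib)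

sublocale Q: vector_space "\<lambda>q::rat. s (of_rat q)"
  by unfold_locales (simp_all add: scale_right_distrib scale_left_distrib of_rat_add of_rat_mult)

lemma Z_span_eq_group_closure: "Z.span X = group_closure X"
proof
  have "s (of_nat n) x \<in> group_closure X" if "x \<in> group_closure X" for n x
    using that by (induction n) (auto simp: scale_left_distrib intro: group_closure_add)
  then have "s (of_int m) x \<in> group_closure X" if "x \<in> group_closure X" for m x
    using that by (cases m rule: int_cases2) auto
  then have "Z.subspace (group_closure X)"
    by (intro Z.subspaceI) (auto intro: group_closure_add)
  then show "Z.span X \<subseteq> group_closure X"
    by (intro Z.span_minimal) (auto intro: group_closure.base)
  show "group_closure X \<subseteq> Z.span X"
  proof
    fix x assume "x \<in> group_closure X"
    then show "x \<in> Z.span X"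
      by induction (auto intro: Z.span_base Z.span_zero Z.span_diff)
  qed
qed

lemma Z_basis_iff: "Z_basis s X L \<longleftrightarrow> Z.independent X \<and> Z.span X = L"
  unfolding Z_basis_def Z_span_eq_group_closure ..

lemma Q_independent_if_Z_independent:
  assumes "Z.independent X"
  shows "Q.independent X"
  unfolding Q.independent_explicit_module
proof (intro allI impI)
  fix t u v
  assume t: "finite t" "t \<subseteq> X" "(\<Sum>v\<in>t. s (of_rat (u v)) v) = 0" "v \<in> t"
  obtain N :: int where N: "N > 0" "\<forall>x\<in>t. \<exists>w. of_int N * u x = of_int w"
    using common_denominator[OF t(1)] by blast
  then obtain w where w: "\<forall>x\<in>t. of_int N * u x = of_int (w x)"
    by metis
  have "(\<Sum>x\<in>t. s (of_int (w x)) x) = (\<Sum>x\<in>t. s (of_rat (of_int N)) (s (of_rat (u x)) x))"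
  proof (rule sum.cong[OF refl])
    fix x assume "x \<in> t"
    then have "of_rat (of_int N * u x) = (of_int (w x) :: complex)"
      using w by simp
    then show "s (of_int (w x)) x = s (of_rat (of_int N)) (s (of_rat (u x)) x)"
      by (simp add: of_rat_mult)
  qed
  also have "\<dots> = s (of_rat (of_int N)) 0"
    unfolding scale_sum_right[symmetric] t(3) ..
  finally have "w v = 0"
    using Z.independentD[OF assms t(1,2) _ t(4), of w] by simp
  then show "u v = 0"
    using w t(4) N by fastforce
qed

lemma Z_independent_if_Q_independent:
  assumes "Q.independent X"
  shows "Z.independent X"
  unfolding Z.independent_explicit_module
proof (intro allI impI)
  fix t and u :: "'v \<Rightarrow> int" and v
  assume t: "finite t" "t \<subseteq> X" "(\<Sum>v\<in>t. s (of_int (u v)) v) = 0" "v \<in> t"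
  then show "u v = 0"
    using Q.independentD[OF assms t(1,2) _ t(4), of "\<lambda>v. of_int (u v)"] by simp
qed

text \<open>Over the integers a maximal independent subset of \<open>F\<close> need not generate
  \<open>F\<close>. Over the rationals it does, and dividing its members by a common denominator
  \<open>N\<close> of all coefficients makes these integral.\<close>

lemma finitely_generated_in_free:
  assumes "finite F"
  shows "\<exists>X. finite X \<and> Z.independent X \<and> F \<subseteq> Z.span X"
proof -
  obtain X where X: "X \<subseteq> F" "Q.independent X" "F \<subseteq> Q.span X"
    using Q.maximal_independent_subset[of F] by blast
  have fin: "finite X"
    using X(1) assms finite_subset by blast
  have "\<exists>u. f = (\<Sum>x\<in>X. s (of_rat (u x)) x)" if "f \<in> F" for f
    using X(3) that unfolding Q.span_finite[OF fin] by auto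
  then obtain u where u: "\<And>f. f \<in> F \<Longrightarrow> f = (\<Sum>x\<in>X. s (of_rat (u f x)) x)"
    by metis
  obtain N :: int where N: "N > 0" "\<forall>p\<in>F \<times> X. \<exists>w. of_int N * u (fst p) (snd p) = of_int w"
    using common_denominator[of "F \<times> X" "\<lambda>p. u (fst p) (snd p)"] assms fin by blast
  then have "\<forall>f\<in>F. \<forall>x\<in>X. \<exists>w. of_int N * u f x = of_int w"
    by auto
  then obtain w where w: "\<And>f x. f \<in> F \<Longrightarrow> x \<in> X \<Longrightarrow> of_int N * u f x = of_int (w f x)"
    by metis
  define g where "g = s (of_rat (1 / of_int N))"
  have lin: "Vector_Spaces.linear (\<lambda>q::rat. s (of_rat q)) (\<lambda>q::rat. s (of_rat q)) g"
    by unfold_locales (simp_all add: g_def scale_right_distrib mult.commute)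
  interpret g: Vector_Spaces.linear "\<lambda>q::rat. s (of_rat q)" "\<lambda>q::rat. s (of_rat q)" g
    by (rule lin)
  have "inj g"
    using N(1) unfolding g_def by (intro injective_scale) auto
  then have "Q.independent (g ` X)"
    using g.independent_injective_image[OF X(2)] inj_on_subset by blast
  moreover have "f \<in> Z.span (g ` X)" if f: "f \<in> F" for f
  proof -
    have "f = (\<Sum>x\<in>X. s (of_int (w f x)) (g x))"
    proof (subst u[OF f], rule sum.cong[OF refl])
      fix x assume x: "x \<in> X"
      have "u f x = of_int (w f x) * (1 / of_int N)"
        using w[OF f x] N(1) by (simp add: field_simps)
      then have "(of_rat (u f x) :: complex) = of_int (w f x) * of_rat (1 / of_int N)"
        by (simp only: of_rat_mult of_rat_of_int_eq)
      then show "s (of_rat (u f x)) x = s (of_int (w f x)) (g x)"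
        by (simp add: g_def)
    qed
    also have "\<dots> \<in> Z.span (g ` X)"
      by (intro Z.span_sum Z.span_scale Z.span_base) auto
    finally show ?thesis .
  qed
  ultimately show ?thesis
    using Z_independent_if_Q_independent fin by blast
qed

text \<open>The coefficients at \<open>a\<close> of elements of \<open>L\<close> form a subgroup of
  the integers, hence consist of the multiples of some \<open>d\<close>. An element \<open>x\<close>
  of \<open>L\<close> with coefficient \<open>d\<close> splits \<open>L\<close> into the multiples
  of \<open>x\<close> and \<open>L \<inter> Z.span X\<close>, to which the induction hypothesis
  applies.\<close>

lemma subgroup_of_free_is_free:
  assumes "finite X" "Z.independent X" "Z.subspace L" "L \<subseteq> Z.span X"
  shows "\<exists>Y. finite Y \<and> Z.independent Y \<and> Z.span Y = L"
  using assms
proof (induction arbitrary: L)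
  case empty
  then have "L = {0}"
    using Z.subspace_0 by auto
  then show ?case
    using Z.independent_empty by (intro exI[of _ "{}"]) simp
next
  case (insert a X)
  have "Z.independent X"
    using insert.prems(1) Z.independent_mono by blast
  moreover have "Z.subspace (L \<inter> Z.span X)"
    using insert.prems(2) by (intro Z.subspace_inter) auto
  ultimately obtain Y where Y: "finite Y" "Z.independent Y" "Z.span Y = L \<inter> Z.span X"
    using insert.IH by (meson inf_le2)
  define J where "J = {n::int. \<exists>y\<in>Z.span X. s (of_int n) a + y \<in> L}"
  have diff: "m - n \<in> J" if "m \<in> J" "n \<in> J" for m n
  proof -
    from that obtain y z where yz: "y \<in> Z.span X" "z \<in> Z.span X"
      "s (of_int m) a + y \<in> L" "s (of_int n) a + z \<in> L"
      unfolding J_def by blast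
    have "s (of_int (m - n)) a + (y - z) = (s (of_int m) a + y) - (s (of_int n) a + z)"
      by (simp add: algebra_simps)
    also have "\<dots> \<in> L"
      using yz insert.prems(2) Z.subspace_diff by blast
    finally show ?thesis
      unfolding J_def using yz Z.span_diff by blast
  qed
  have zero: "0 \<in> J"
    unfolding J_def using insert.prems(2) Z.subspace_0 Z.span_zero by force
  have "m \<in> J" if "m \<in> group_closure J" for m
    using that by induction (use zero in \<open>auto intro: diff\<close>)
  then have "group_closure J = J"
    by (auto intro: group_closure.base)
  then have J: "J = range (times (Gcd J))"
    using group_closure_eq[of J] by simp
  define d where "d = Gcd J"
  have "d \<in> J"
    using J unfolding d_def by (metis mult.right_neutral rangeI)
  then obtain y where y: "y \<in> Z.span X" "s (of_int d) a + y \<in> L"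
    unfolding J_def by blast
  define x where "x = s (of_int d) a + y"
  have decomp: "\<exists>k. z - s (of_int k) x \<in> L \<inter> Z.span X" if z: "z \<in> L" for z
  proof -
    obtain n where n: "z - s (of_int n) a \<in> Z.span X"
      using z insert.prems(3) Z.span_breakdown_eq by blast
    have "s (of_int n) a + (z - s (of_int n) a) \<in> L"
      using z by simp
    then have "n \<in> J"
      unfolding J_def using n by blast
    then obtain k where k: "n = d * k"
      using J unfolding d_def by blast
    have "z - s (of_int k) x = (z - s (of_int n) a) - s (of_int k) y"
      by (simp add: x_def k algebra_simps)
    also have "\<dots> \<in> Z.span X"
      using n y Z.span_diff Z.span_scale by blast
    finally have "z - s (of_int k) x \<in> Z.span X" .
    moreover have "z - s (of_int k) x \<in> L"
      using z y(2) insert.prems(2) Z.subspace_diff Z.subspace_scale unfolding x_def by blast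
    ultimately show ?thesis by blast
  qed
  show ?case
  proof (cases "d = 0")
    \<comment> \<open>Now \<open>x\<close> lies in \<open>Z.span X\<close> itself, and
      \<open>Y\<close> already generates all of \<open>L\<close>.\<close>
    case True
    then have "x \<in> L \<inter> Z.span X"
      using y by (simp add: x_def)
    then have "L \<subseteq> Z.span X"
      using decomp Z.span_add[OF _ Z.span_scale[of x X]]
      by (metis IntD2 diff_add_cancel subsetI)
    then show ?thesis
      using Y by (intro exI[of _ Y]) auto
  next
    case False
    have "k = 0" if k: "s (of_int k) x \<in> Z.span Y" for k
    proof -
      have "s (of_int (k * d)) a = s (of_int k) x - s (of_int k) y"
        by (simp add: x_def algebra_simps)
      also have "\<dots> \<in> Z.span X"
        using k Y(3) y(1) Z.span_diff Z.span_scale by blast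
      finally have "k * d = 0"
        using Z.independent_insertD_scale[OF insert.prems(1) insert.hyps(2)] by blast
      then show ?thesis using False by simp
    qed
    then have "Z.independent (insert x Y)"
      using Z.independent_insertI_torsion_free[OF Y(2)] by blast
    moreover have "Z.span (insert x Y) = L"
    proof
      have "Y \<subseteq> L"
        using Y(3) Z.span_superset by blast
      then show "Z.span (insert x Y) \<subseteq> L"
        using y(2) insert.prems(2) by (intro Z.span_minimal) (auto simp: x_def)
      show "L \<subseteq> Z.span (insert x Y)"
        using decomp unfolding Z.span_insert Y(3) by blast
    qed
    ultimately show ?thesis
      using Y(1) by (intro exI[of _ "insert x Y"]) auto
  qed
qed

text \<open>
  Elements of \<open>X\<close> outside \<open>H\<close> are exchanged one at a time: some member of \<open>H\<close> has an odd coefficient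
  at such an element, and modulo \<open>2L\<close> all its coefficients may be taken to be 0 or 1.
\<close>

lemma basis_in_generating_union_of_cosets:
  assumes "finite X" "Z_basis s X L" "H \<subseteq> L" "L \<subseteq> Z.span H"
    and cosets: "\<And>h x. h \<in> H \<Longrightarrow> x \<in> L \<Longrightarrow> h + s 2 x \<in> H"
  shows "\<exists>Y\<subseteq>H. Z_basis s Y L"
  using assms(1,2)
proof (induction "card (X - H)" arbitrary: X rule: less_induct)
  case less
  have ind: "Z.independent X" and span: "Z.span X = L"
    using less.prems by (simp_all add: Z_basis_iff)
  show ?case
  proof (cases "X \<subseteq> H")
    case True
    then show ?thesis using less.prems by blast
  next
    case False
    define odd_at where "odd_at = (\<lambda>h a u. h = (\<Sum>x\<in>X. s (of_int (u x)) x) \<and> odd (u a :: int))"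
    have "\<exists>h\<in>H. \<exists>a\<in>X - H. \<exists>u. odd_at h a u"
    proof (rule ccontr)
      assume no: "\<not> ?thesis"
      obtain a where a: "a \<in> X" "a \<notin> H"
        using False by blast
      \<comment> \<open>If all members of \<open>H\<close> had an even coefficient at
        \<open>a\<close>, so would everything they generate, including \<open>a\<close>, whose
        coefficient is 1.\<close>
      define E where "E = {z. \<exists>u. z = (\<Sum>x\<in>X. s (of_int (u x)) x) \<and> even (u a :: int)}"
      have "Z.subspace E"
      proof (rule Z.subspaceI)
        show "0 \<in> E"
          unfolding E_def by (intro CollectI exI[of _ "\<lambda>_. 0"]) simp
        fix x y assume "x \<in> E" "y \<in> E"
        then obtain u v where "x = (\<Sum>x\<in>X. s (of_int (u x)) x)" "even (u a :: int)"
          "y = (\<Sum>x\<in>X. s (of_int (v x)) x)" "even (v a :: int)"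
          unfolding E_def by blast
        then show "x + y \<in> E"
          unfolding E_def
          by (intro CollectI exI[of _ "\<lambda>x. u x + v x"]) (simp add: scale_left_distrib sum.distrib)
      next
        fix c :: int and x assume "x \<in> E"
        then obtain u where "x = (\<Sum>x\<in>X. s (of_int (u x)) x)" "even (u a :: int)"
          unfolding E_def by blast
        then show "s (of_int c) x \<in> E"
          unfolding E_def
          by (intro CollectI exI[of _ "\<lambda>x. c * u x"]) (simp add: scale_sum_right)
      qed
      moreover have "H \<subseteq> E"
      proof
        fix h assume h: "h \<in> H"
        then have "h \<in> Z.span X"
          using assms(3) span by blast
        then obtain u where "h = (\<Sum>x\<in>X. s (of_int (u x)) x)"
          unfolding Z.span_finite[OF less.prems(1)] by blast
        then show "h \<in> E"
          using no a h unfolding odd_at_def E_def by blast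
      qed
      ultimately have "L \<subseteq> E"
        using assms(4) Z.span_minimal by blast
      then have "a \<in> E"
        using a span Z.span_base by blast
      then obtain u where u: "a = (\<Sum>x\<in>X. s (of_int (u x)) x)" "even (u a :: int)"
        unfolding E_def by blast
      \<comment> \<open>Comparing the two expansions of \<open>a\<close> gives a relation with the
        odd coefficient \<open>u a - 1\<close> at \<open>a\<close>.\<close>
      have "(\<Sum>x\<in>X. s (of_int (u x - (if x = a then 1 else 0))) x)
          = (\<Sum>x\<in>X. s (of_int (u x)) x) - (\<Sum>x\<in>X. if x = a then a else 0)"
        unfolding sum_subtractf[symmetric] by (rule sum.cong) (auto simp: scale_left_diff_distrib)
      also have "\<dots> = 0"
        using u(1) a less.prems(1) by (simp add: sum.delta)
      finally have "u a - (if a = a then 1 else 0) = 0"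
        using Z.independentD[OF ind less.prems(1) order.refl _ a(1),
            of "\<lambda>x. u x - (if x = a then 1 else 0)"] by blast
      then show False using u(2) by simp
    qed
    then obtain h a u where h: "h \<in> H" "a \<in> X" "a \<notin> H"
      and u: "h = (\<Sum>x\<in>X. s (of_int (u x)) x)" "odd (u a)"
      unfolding odd_at_def by blast
    \<comment> \<open>Reduction modulo 2 keeps the element in \<open>H\<close> and makes its
      coefficient at \<open>a\<close> exactly 1, so that exchanging \<open>a\<close> for
      \<open>g\<close> is invertible over the integers.\<close>
    define g where "g = (\<Sum>x\<in>X. s (of_int (u x mod 2)) x)"
    have "g = h + s 2 (\<Sum>x\<in>X. s (of_int (- (u x div 2))) x)"
      unfolding g_def u(1) scale_sum_right sum.distrib[symmetric]
    proof (rule sum.cong[OF refl])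
      fix x
      have "of_int (u x mod 2) = (of_int (u x + 2 * (- (u x div 2))) :: complex)"
        by (rule arg_cong[where f = of_int]) (simp add: minus_div_mult_eq_mod[symmetric])
      also have "\<dots> = of_int (u x) + 2 * of_int (- (u x div 2))"
        by (simp only: of_int_add of_int_mult of_int_numeral)
      finally show "s (of_int (u x mod 2)) x = s (of_int (u x)) x + s 2 (s (of_int (- (u x div 2))) x)"
        by (simp add: scale_left_diff_distrib)
    qed
    moreover have "(\<Sum>x\<in>X. s (of_int (- (u x div 2))) x) \<in> L"
      unfolding span[symmetric] by (intro Z.span_sum Z.span_scale Z.span_base)
    ultimately have gH: "g \<in> H"
      using cosets h(1) by simp
    define r where "r = (\<Sum>x\<in>X - {a}. s (of_int (u x mod 2)) x)"
    have r: "r \<in> Z.span (X - {a})"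
      unfolding r_def by (intro Z.span_sum Z.span_scale Z.span_base)
    have g: "g = a + r"
      using u(2) sum.remove[OF less.prems(1) h(2), of "\<lambda>x. s (of_int (u x mod 2)) x"]
      by (simp add: g_def r_def odd_iff_mod_2_eq_one)
    define X' where "X' = insert g (X - {a})"
    have Xa: "insert a (X - {a}) = X"
      using h(2) by blast
    have "Z.independent X'"
      unfolding X'_def
    proof (rule Z.independent_insertI_torsion_free)
      show "Z.independent (X - {a})"
        using ind Z.independent_mono by blast
      fix k assume k: "s (of_int k) g \<in> Z.span (X - {a})"
      have "s (of_int k) a = s (of_int k) g - s (of_int k) r"
        by (simp add: g scale_right_distrib)
      also have "\<dots> \<in> Z.span (X - {a})"
        using k r Z.span_diff Z.span_scale by blast
      finally show "k = 0"
        using Z.independent_insertD_scale[of a "X - {a}" k] ind Xa by simp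
    qed
    moreover have "Z.span X' = L"
    proof
      show "Z.span X' \<subseteq> L"
        unfolding X'_def using gH assms(3) Z.span_superset[of X] span Z.subspace_span[of X]
        by (intro Z.span_minimal) auto
      have "g - r \<in> Z.span X'"
        using r Z.span_mono[of "X - {a}" X'] Z.span_base[of g X']
        by (intro Z.span_diff) (auto simp: X'_def)
      then have "a \<in> Z.span X'"
        by (simp add: g)
      moreover have "X - {a} \<subseteq> Z.span X'"
        using Z.span_superset[of X'] by (auto simp: X'_def)
      ultimately have "X \<subseteq> Z.span X'" by blast
      then show "L \<subseteq> Z.span X'"
        unfolding span[symmetric] by (intro Z.span_minimal) auto
    qed
    moreover have "card (X' - H) < card (X - H)"
    proof (rule psubset_card_mono)
      show "finite (X - H)" using less.prems(1) by simp
      have "X' - H \<subseteq> X - H" "a \<in> X - H" "a \<notin> X' - H"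
        using gH h by (auto simp: X'_def)
      then show "X' - H \<subset> X - H"
        by blast
    qed
    moreover have "finite X'"
      using less.prems(1) by (simp add: X'_def)
    ultimately show ?thesis
      using less.hyps[of X'] by (simp add: Z_basis_iff)
  qed
qed

end

subsection \<open>Complex independence from the tensor product\<close>

locale int_module = module scale for scale :: "int \<Rightarrow> 'b::ab_group_add \<Rightarrow> 'b"
begin

text \<open>The homomorphism on the free abelian group that extends \<open>g\<close>. It is used
  with values in the space, where it gives \<open>tensor_eval\<close>, and in the complex numbers,
  where it detects coefficients.\<close>

definition frag_eval :: "('c \<Rightarrow> 'b) \<Rightarrow> ('c \<Rightarrow>\<^sub>0 int) \<Rightarrow> 'b" where
  "frag_eval g t = (\<Sum>k\<in>Poly_Mapping.keys t. scale (Poly_Mapping.lookup t k) (g k))"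

lemma frag_eval_superset:
  assumes "finite A" "Poly_Mapping.keys t \<subseteq> A"
  shows "frag_eval g t = (\<Sum>k\<in>A. scale (Poly_Mapping.lookup t k) (g k))"
  unfolding frag_eval_def using assms
  by (intro sum.mono_neutral_left) (auto simp: in_keys_iff)

lemma frag_eval_diff: "frag_eval g (t - u) = frag_eval g t - frag_eval g u"
proof -
  \<comment> \<open>Cancellation can shrink the support of \<open>t - u\<close>, so all three sums
    are taken over one common set.\<close>
  let ?A = "Poly_Mapping.keys t \<union> Poly_Mapping.keys u"
  have "Poly_Mapping.keys (t - u) \<subseteq> ?A"
    by (auto simp: in_keys_iff lookup_minus)
  then show ?thesis
    by (simp add: frag_eval_superset[of ?A] lookup_minus scale_left_diff_distrib sum_subtractf)
qed

lemma frag_eval_zero: "frag_eval g 0 = 0"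
  by (simp add: frag_eval_def)

lemma frag_eval_add: "frag_eval g (t + u) = frag_eval g t + frag_eval g u"
  using frag_eval_diff[of g "t + u" u] by (simp add: algebra_simps)

lemma frag_eval_sum: "frag_eval g (\<Sum>i\<in>I. t i) = (\<Sum>i\<in>I. frag_eval g (t i))"
  by (induction I rule: infinite_finite_induct) (simp_all add: frag_eval_zero frag_eval_add)

lemma frag_eval_of: "frag_eval g (Poly_Mapping.single x 1) = g x"
  by (simp add: frag_eval_def)

text \<open>The universal property of the tensor product: a biadditive \<open>g\<close> factors
  through the quotient by the relations.\<close>

lemma frag_eval_tensor_rels:
  assumes t: "t \<in> tensor_rels M"
    and "\<And>x y c. x \<in> M \<Longrightarrow> y \<in> M \<Longrightarrow> g (x + y, c) = g (x, c) + g (y, c)"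
    and "\<And>x c d. x \<in> M \<Longrightarrow> g (x, c + d) = g (x, c) + g (x, d)"
  shows "frag_eval g t = 0"
  using t unfolding tensor_rels_def
proof induction
  case (base t)
  then show ?case
    by (auto simp: frag_eval_zero frag_eval_diff frag_eval_of assms(2,3))
next
  case (diff t u)
  then show ?case by (simp add: frag_eval_diff)
qed

end

context complex_space
begin

sublocale Z: int_module "\<lambda>m::int. s (of_int m)" ..

lemma tensor_eval_eq: "tensor_eval s t = Z.frag_eval (\<lambda>(x, c). s c x) t"
  unfolding tensor_eval_def Z.frag_eval_def by (rule sum.cong) auto

lemma tensor_eval_rels:
  assumes "t \<in> tensor_rels M"
  shows "tensor_eval s t = 0"
  unfolding tensor_eval_eq using assms
  by (rule Z.frag_eval_tensor_rels) (simp_all add: scale_left_distrib scale_right_distrib)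

definition tensor_class :: "'v set \<Rightarrow> ('v \<times> complex \<Rightarrow>\<^sub>0 int) \<Rightarrow> ('v \<times> complex \<Rightarrow>\<^sub>0 int) set" where
  "tensor_class M t = {u. t \<in> tensor_free M \<and> u \<in> tensor_free M \<and> t - u \<in> tensor_rels M}"

lemma tensor_complex_eq: "tensor_complex M = tensor_class M ` tensor_free M"
  unfolding tensor_complex_def quotient_def tensor_class_def by auto

lemma self_in_tensor_class: "t \<in> tensor_free M \<Longrightarrow> t \<in> tensor_class M t"
  by (simp add: tensor_class_def tensor_rels_def)

lemma tensor_map_class:
  assumes "t \<in> tensor_free M"
  shows "tensor_map s (tensor_class M t) = tensor_eval s t"
proof -
  have "tensor_eval s u = tensor_eval s t" if "u \<in> tensor_class M t" for u
  proof -
    have "tensor_eval s (t - u) = 0"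
      using that tensor_eval_rels unfolding tensor_class_def by blast
    then show ?thesis
      by (simp add: tensor_eval_eq Z.frag_eval_diff)
  qed
  then have "tensor_eval s ` tensor_class M t \<subseteq> {tensor_eval s t}"
    by blast
  then have "tensor_eval s ` tensor_class M t = {tensor_eval s t}"
    using self_in_tensor_class[OF assms] by blast
  then show ?thesis
    by (simp add: tensor_map_def)
qed

text \<open>Injectivity brought down to representatives: \<open>t\<close> and 0 have the same image,
  hence the same class.\<close>

lemma tensor_rels_if_eval_zero:
  assumes bij: "bij_betw (tensor_map s) (tensor_complex M) UNIV"
    and t: "t \<in> tensor_free M" "tensor_eval s t = 0"
  shows "t \<in> tensor_rels M"
proof -
  have zero: "0 \<in> tensor_free M"
    by (simp add: tensor_free_def)
  have "tensor_map s (tensor_class M t) = tensor_map s (tensor_class M 0)"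
    using t zero by (simp add: tensor_map_class) (simp add: tensor_eval_def)
  then have "tensor_class M t = tensor_class M 0"
    using bij t zero unfolding bij_betw_def inj_on_def tensor_complex_eq by blast
  then have "0 \<in> tensor_class M t"
    using self_in_tensor_class[OF zero] by simp
  then show ?thesis
    by (simp add: tensor_class_def)
qed

lemma span_if_tensor_map_surj:
  assumes bij: "bij_betw (tensor_map s) (tensor_complex M) UNIV"
  shows "span M = UNIV"
proof -
  have "v \<in> span M" for v
  proof -
    have "tensor_map s ` tensor_class M ` tensor_free M = UNIV"
      using bij unfolding bij_betw_def tensor_complex_eq by (rule conjunct2)
    then have "v \<in> tensor_map s ` tensor_class M ` tensor_free M"
      by simp
    then obtain t where t: "t \<in> tensor_free M" "v = tensor_eval s t"
      using tensor_map_class by auto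
    show ?thesis
      unfolding t(2) tensor_eval_def
    proof (rule span_sum)
      fix p assume "p \<in> Poly_Mapping.keys t"
      then have "fst p \<in> M"
        using t(1) by (auto simp: tensor_free_def)
      then show "(case p of (x, c) \<Rightarrow> s (of_int (Poly_Mapping.lookup t (x, c)) * c) x) \<in> span M"
        by (cases p) (simp add: span_base span_scale)
    qed
  qed
  then show ?thesis by (simp add: set_eq_iff)
qed

text \<open>
  A rational-linear functional \<open>f\<close> on \<open>V\<close> induces \<open>x \<otimes> c \<mapsto> f(x)c\<close> on the tensor product; the
  coordinate functionals of a rational basis containing \<open>X\<close> therefore detect the coefficients of a
  complex relation between elements of \<open>X\<close>.
\<close>

lemma independent_if_Z_independent:
  assumes bij: "bij_betw (tensor_map s) (tensor_complex M) UNIV"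
    and X: "X \<subseteq> M" "Z.independent X"
  shows "independent X"
  unfolding independent_explicit_module
proof (intro allI impI)
  fix t u v
  assume t: "finite t" "t \<subseteq> X" "(\<Sum>v\<in>t. s (u v) v) = 0" "v \<in> t"
  interpret C: int_module "\<lambda>(m::int) (z::complex). of_int m * z"
    by unfold_locales (simp_all add: algebra_simps)
  define E where "E = Q.extend_basis X"
  have XQ: "Q.independent X"
    by (rule Q_independent_if_Z_independent[OF X(2)])
  have E: "X \<subseteq> E" "Q.independent E" "Q.span E = UNIV"
    unfolding E_def
    by (rule Q.extend_basis_superset[OF XQ] Q.independent_extend_basis[OF XQ]
        Q.span_extend_basis[OF XQ])+
  \<comment> \<open>The rational coordinate at \<open>v\<close>: it is 1 at \<open>v\<close> and 0
    on the rest of \<open>t\<close>, so it isolates \<open>u v\<close>.\<close>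
  define f where "f x = (of_rat (Q.representation E x v) :: complex)" for x
  have f_add: "f (x + y) = f x + f y" for x y
    unfolding f_def using E by (simp add: Q.representation_add of_rat_add)
  have f_basis: "f x = (if x = v then 1 else 0)" if "x \<in> t" for x
    unfolding f_def using E t(2) that by (subst Q.representation_basis) auto
  \<comment> \<open>Since \<open>f\<close> is additive but not complex linear, it cannot be applied
    to the given relation. The relation is lifted to a formal sum of pairs, which evaluates to 0 and
    so lies in the tensor relations, where \<open>f x * c\<close> is a legitimate biadditive
    map.\<close>
  define w where "w = (\<Sum>x\<in>t. Poly_Mapping.single (x, u x) (1::int))"
  have "Poly_Mapping.keys w \<subseteq> M \<times> UNIV"
    unfolding w_def using t(2) X(1) by (intro order.trans[OF keys_sum]) auto
  then have "w \<in> tensor_free M"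
    by (simp add: tensor_free_def)
  moreover have "tensor_eval s w = 0"
    unfolding tensor_eval_eq w_def Z.frag_eval_sum Z.frag_eval_of using t(3) by simp
  ultimately have "w \<in> tensor_rels M"
    by (rule tensor_rels_if_eval_zero[OF bij])
  then have "C.frag_eval (\<lambda>(x, c). f x * c) w = 0"
    by (rule C.frag_eval_tensor_rels) (simp_all add: f_add algebra_simps)
  then have "(\<Sum>x\<in>t. f x * u x) = 0"
    unfolding w_def C.frag_eval_sum C.frag_eval_of by simp
  moreover have "(\<Sum>x\<in>t. f x * u x) = (\<Sum>x\<in>t. if x = v then u v else 0)"
    by (intro sum.cong) (auto simp: f_basis)
  ultimately show "u v = 0"
    using t(1,4) by simp
qed

text \<open>Finite generation yields an integral basis \<open>Y\<close> of \<open>L\<close>; by the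
  tensor condition it is also a complex basis of \<open>K\<close>, and so \<open>card Y\<close> is
  both the rank and the dimension.\<close>

lemma free_of_rank_dim:
  assumes bij: "bij_betw (tensor_map s) (tensor_complex (group_closure R)) UNIV"
    and fg: "finite F" "group_closure F = group_closure R"
    and L: "Z.subspace L" "L \<subseteq> group_closure R" "span L = K"
  shows "free_of_rank s L (dim K)"
proof -
  obtain X where X: "finite X" "Z.independent X" "F \<subseteq> Z.span X"
    using finitely_generated_in_free[OF fg(1)] by blast
  have "L \<subseteq> Z.span X"
    using L(2) Z.span_minimal[OF X(3) Z.subspace_span] fg(2)
    by (simp add: Z_span_eq_group_closure)
  then obtain Y where Y: "finite Y" "Z.independent Y" "Z.span Y = L"
    using subgroup_of_free_is_free[OF X(1,2) L(1)] by blast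
  have YL: "Y \<subseteq> L"
    using Y(3) Z.span_superset by blast
  then have "independent Y"
    using independent_if_Z_independent[OF bij _ Y(2)] L(2) by blast
  moreover have "L \<subseteq> span Y"
  proof -
    have "Z.subspace (span Y)"
      by (intro Z.subspaceI) (auto intro: span_zero span_add span_scale)
    then show ?thesis
      unfolding Y(3)[symmetric] by (intro Z.span_minimal) (auto intro: span_base)
  qed
  then have "span Y = K"
    unfolding L(3)[symmetric] using YL
    by (metis span_mono span_minimal subspace_span subset_antisym)
  ultimately have "card Y = dim K"
    using dim_span_eq_card_independent by metis
  then show ?thesis
    unfolding free_of_rank_def Z_basis_iff using Y by blast
qed

end

subsection \<open>Reduction modulo two\<close>

lemma bit_of_int_eq_0_iff: "(of_int m :: bit) = 0 \<longleftrightarrow> even m"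
  by (cases "even m") (auto elim!: evenE oddE)

text \<open>The scalar multiplication is spelled as in \<open>F2_basis\<close>, so that its
  \<open>module.span\<close> and \<open>module.dependent\<close> are those of this
  interpretation.\<close>

interpretation F2: vector_space "\<lambda>(a::bit) (f :: nat \<Rightarrow> bit) i. a * f i"
  by unfold_locales (auto simp: fun_eq_iff algebra_simps)

text \<open>Coordinates in an integral basis are reduced modulo 2; an element whose coordinates are
  all even is twice the element with the halved coordinates.\<close>

lemma (in complex_space) quotient_map_F2_exists:
  assumes "free_of_rank s L k"
  shows "\<exists>\<phi>. quotient_map_F2 L (s 2 ` L) k \<phi>"
proof -
  obtain X where X: "finite X" "card X = k" "Z.independent X" "Z.span X = L"
    using assms unfolding free_of_rank_def Z_basis_iff by blast
  obtain b where b: "bij_betw b {0..<k} X"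
    using X(1,2) ex_bij_betw_nat_finite by blast
  \<comment> \<open>The value 0 from \<open>k\<close> on is what membership in \<open>F2 k\<close>
    demands.\<close>
  define \<phi> where
    "\<phi> x = (\<lambda>i. if i < k then of_int (Z.representation X x (b i)) else 0 :: bit)" for x
  have add: "\<phi> (x + y) = \<phi> x + \<phi> y" if "x \<in> L" "y \<in> L" for x y
    using that X(3,4) by (auto simp: \<phi>_def fun_eq_iff Z.representation_add)
  have bX: "b i \<in> X" if "i < k" for i
    using b that unfolding bij_betw_def by auto
  have expand: "x = (\<Sum>v\<in>X. s (of_int (Z.representation X x v)) v)" if "x \<in> L" for x
    using Z.sum_representation_eq[OF X(3) _ X(1) order.refl, of x] X(4) that by simp
  have "\<phi> ` L = F2 k"
  proof
    show "\<phi> ` L \<subseteq> F2 k"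
      by (auto simp: \<phi>_def F2_def)
    show "F2 k \<subseteq> \<phi> ` L"
    proof
      fix f assume f: "f \<in> F2 k"
      \<comment> \<open>The lift of \<open>f\<close> to coefficients 0 and 1. It vanishes off
        \<open>X\<close> because it has to be the representation of \<open>x\<close> on all
        vectors.\<close>
      define u where "u v = (if v \<in> X then of_bool (f (inv_into {0..<k} b v) = 1) else 0 :: int)" for v
      define x where "x = (\<Sum>v\<in>X. s (of_int (u v)) v)"
      have "x \<in> L"
        unfolding x_def X(4)[symmetric] by (intro Z.span_sum Z.span_scale Z.span_base)
      moreover have rep: "Z.representation X x = u"
      proof (rule Z.representation_eqI[OF X(3)])
        show "x \<in> Z.span X"
          using \<open>x \<in> L\<close> X(4) by simp
        show "v \<in> X" if "u v \<noteq> 0" for v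
          using that by (auto simp: u_def split: if_splits)
        show "finite {v. u v \<noteq> 0}"
          using X(1) by (rule finite_subset[rotated]) (auto simp: u_def)
        show "(\<Sum>v | u v \<noteq> 0. s (of_int (u v)) v) = x"
          unfolding x_def using X(1) by (intro sum.mono_neutral_left) (auto simp: u_def)
      qed
      have "\<phi> x = f"
      proof
        fix i
        show "\<phi> x i = f i"
        proof (cases "i < k")
          case True
          then have "inv_into {0..<k} b (b i) = i"
            using b unfolding bij_betw_def by (intro inv_into_f_f) auto
          then show ?thesis
            using True bX by (cases "f i") (auto simp: \<phi>_def rep u_def)
        next
          case False
          then show ?thesis
            using f by (simp add: \<phi>_def F2_def)
        qed
      qed
      ultimately show "f \<in> \<phi> ` L" by blast
    qed
  qed
  moreover have "{x \<in> L. \<phi> x = 0} = s 2 ` L"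
  proof (intro subset_antisym subsetI)
    fix x assume "x \<in> {x \<in> L. \<phi> x = 0}"
    then have x: "x \<in> L" "\<phi> x = 0" by simp_all
    have ev: "even (Z.representation X x v)" if v: "v \<in> X" for v
    proof -
      obtain i where i: "i < k" "b i = v"
        using b v unfolding bij_betw_def by auto
      have "\<phi> x i = 0"
        using x(2) by simp
      then show ?thesis
        using i by (simp add: \<phi>_def bit_of_int_eq_0_iff)
    qed
    define y where "y = (\<Sum>v\<in>X. s (of_int (Z.representation X x v div 2)) v)"
    have "y \<in> L"
      unfolding y_def X(4)[symmetric] by (intro Z.span_sum Z.span_scale Z.span_base)
    moreover have "s 2 y = x"
      unfolding y_def scale_sum_right
    proof (subst (2) expand[OF x(1)], rule sum.cong[OF refl])
      fix v assume "v \<in> X"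
      then have "of_int (Z.representation X x v) = (of_int (2 * (Z.representation X x v div 2)) :: complex)"
        using ev by simp
      also have "\<dots> = 2 * of_int (Z.representation X x v div 2)"
        by (simp only: of_int_mult of_int_numeral)
      finally show "s 2 (s (of_int (Z.representation X x v div 2)) v) = s (of_int (Z.representation X x v)) v"
        by simp
    qed
    ultimately show "x \<in> s 2 ` L" by blast
  next
    fix x assume "x \<in> s 2 ` L"
    then obtain y where y: "y \<in> L" "x = y + y"
      using scale_left_distrib[of 1 1] by auto
    have "y + y \<in> L"
      using y(1) X(4) Z.span_add by blast
    moreover have "\<phi> (y + y) = 0"
      using add[OF y(1) y(1)] by (simp add: fun_eq_iff)
    ultimately show "x \<in> {x \<in> L. \<phi> x = 0}"
      using y by simp
  qed
  ultimately show ?thesis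
    unfolding quotient_map_F2_def using add by blast
qed

text \<open>A set stable under adding elements of the kernel is a union of cosets, hence the full
  preimage of its image. All the sets \<open>S\<close>, \<open>S1\<close>, \<open>S2\<close> of the
  theorem arise as such images.\<close>

lemma quotient_map_F2_saturated:
  assumes \<phi>: "quotient_map_F2 A A' k \<phi>"
    and A: "\<And>x y. x \<in> A \<Longrightarrow> y \<in> A \<Longrightarrow> x - y \<in> A"
    and H: "H \<subseteq> A" "\<And>h x. h \<in> H \<Longrightarrow> x \<in> A' \<Longrightarrow> h + x \<in> H"
  shows "\<phi> ` H \<subseteq> F2 k" "H = {x \<in> A. \<phi> x \<in> \<phi> ` H}"
proof -
  show "\<phi> ` H \<subseteq> F2 k"
    using \<phi> H(1) unfolding quotient_map_F2_def by blast
  have "x \<in> H" if x: "x \<in> A" "h \<in> H" "\<phi> x = \<phi> h" for x h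
  proof -
    have "x - h \<in> A" "h \<in> A"
      using x A H(1) by auto
    then have "\<phi> ((x - h) + h) = \<phi> (x - h) + \<phi> h"
      using \<phi> unfolding quotient_map_F2_def by blast
    then have "\<phi> (x - h) = 0"
      using x(3) by simp
    then have "x - h \<in> A'"
      using \<phi> \<open>x - h \<in> A\<close> unfolding quotient_map_F2_def by blast
    then show ?thesis
      using H(2)[OF x(2), of "x - h"] by simp
  qed
  then show "H = {x \<in> A. \<phi> x \<in> \<phi> ` H}"
    using H(1) by blast
qed

text \<open>The image of a generating set spans, and a spanning set of a vector space contains a
  basis.\<close>

lemma F2_basis_in_image_of_generators:
  assumes \<phi>: "quotient_map_F2 A A' k \<phi>" and H: "group_closure H = A"
  shows "\<exists>T\<subseteq>\<phi> ` H. F2_basis T k"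
proof -
  have add: "\<phi> (x + y) = \<phi> x + \<phi> y" if "x \<in> A" "y \<in> A" for x y
    using \<phi> that unfolding quotient_map_F2_def by blast
  have "\<phi> x \<in> F2.span (\<phi> ` H)" if "x \<in> group_closure H" for x
    using that
  proof induction
    case (base x)
    \<comment> \<open>The base case of \<open>group_closure\<close> includes 0, which need not
      belong to \<open>H\<close>.\<close>
    have "\<phi> 0 = 0"
      using add[of 0 0] H zero_in_group_closure by fastforce
    with base have "\<phi> x = 0 \<or> \<phi> x \<in> \<phi> ` H"
      by blast
    then show ?case
      using F2.span_base F2.span_zero by metis
  next
    case (diff x y)
    have "\<phi> ((x - y) + y) = \<phi> (x - y) + \<phi> y"
      using diff.hyps H by (intro add) (auto intro: group_closure.diff)
    then have "\<phi> (x - y) = \<phi> x - \<phi> y"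
      by (simp add: algebra_simps)
    then show ?case
      by (simp only: F2.span_diff[OF diff.IH])
  qed
  then have "\<phi> ` group_closure H \<subseteq> F2.span (\<phi> ` H)"
    by (rule image_subsetI)
  moreover have img: "\<phi> ` group_closure H = F2 k"
    using \<phi> unfolding quotient_map_F2_def H by (rule conjunct1)
  ultimately have gen: "F2 k \<subseteq> F2.span (\<phi> ` H)"
    by (simp only:)
  obtain T where T: "T \<subseteq> \<phi> ` H" "F2.independent T" "\<phi> ` H \<subseteq> F2.span T"
    using F2.maximal_independent_subset[of "\<phi> ` H"] .
  have "F2.subspace (F2 k)"
    by (intro F2.subspaceI) (auto simp: F2_def)
  moreover have "T \<subseteq> F2 k"
    using T(1) group_closure.base[of _ H] unfolding img[symmetric] by blast
  ultimately have "F2.span T \<subseteq> F2 k"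
    by (intro F2.span_minimal)
  moreover have "F2.span (\<phi> ` H) \<subseteq> F2.span T"
    by (intro F2.span_minimal T(3) F2.subspace_span)
  then have "F2 k \<subseteq> F2.span T"
    by (rule order.trans[OF gen])
  ultimately have "F2.span T = F2 k"
    by (rule subset_antisym)
  then show ?thesis
    unfolding F2_basis_def using T(1,2) by (intro exI[of _ T] conjI)
qed

subsection \<open>Roots over a root system of type BC\<close>

lemma std_form_add_left: "std_form (x + y) z = std_form x z + std_form y z"
  and std_form_scale_left: "std_form (c *s x) z = c * std_form x z"
  and std_form_commute: "std_form x y = std_form y x"
  by (simp_all add: std_form_def algebra_simps sum.distrib sum_distrib_left)

lemma std_form_std_basis: "std_form x (std_basis i) = x $ i"
  by (simp add: std_form_def std_basis_def axis_def if_distrib cong: if_cong)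

lemma std_basis_nth: "std_basis i $ j = (if i = j then 1 else 0)"
  by (simp add: std_basis_def axis_def)

text \<open>Here \<open>q\<close> is the projection modulo the kernel followed by the identification
  with \<open>complex ^ 'n\<close>, and \<open>B\<close> is assumed already rescaled, so
  \<open>form_eq\<close> carries no constant.\<close>

locale BC_cover = complex_space s
  for s :: "complex \<Rightarrow> 'v::ab_group_add \<Rightarrow> 'v" +
  fixes B :: "'v \<Rightarrow> 'v \<Rightarrow> complex" and R :: "'v set" and q :: "'v \<Rightarrow> complex ^ 'n::finite"
  assumes q_add: "q (x + y) = q x + q y"
    and q_scale: "q (s c x) = c *s q x"
    and form_eq: "B x y = std_form (q x) (q y)"
    and image_q: "q ` R = BC"
    and reflection_closed: "\<alpha> \<in> R \<Longrightarrow> B \<alpha> \<alpha> \<noteq> 0 \<Longrightarrow> reflection s B \<alpha> ` R \<subseteq> R"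
begin

lemma q_uminus: "q (- x) = - q x"
  using q_scale[of "-1" x] by (simp add: vec_eq_iff)

lemma q_diff: "q (x - y) = q x - q y"
  using q_add[of x "- y"] by (simp add: q_uminus)

lemma q_zero: "q 0 = 0"
  using q_diff[of 0 0] by simp

lemma form_commute: "B x y = B y x"
  unfolding form_eq by (rule std_form_commute)

lemma form_add_left: "B (x + y) z = B x z + B y z"
  and form_scale_left: "B (s c x) z = c * B x z"
  by (simp_all add: form_eq q_add q_scale std_form_add_left std_form_scale_left)

lemma form_uminus_left: "B (- x) z = - B x z"
  using form_scale_left[of "-1"] by simp

lemma form_diff_left: "B (x - y) z = B x z - B y z"
  using form_add_left[of x "- y"] by (simp add: form_uminus_left)

lemma form_add_right: "B z (x + y) = B z x + B z y"
  and form_scale_right: "B z (s c x) = c * B z x"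
  and form_uminus_right: "B z (- x) = - B z x"
  and form_diff_right: "B z (x - y) = B z x - B z y"
  unfolding form_commute[of z]
  by (simp_all add: form_add_left form_scale_left form_uminus_left form_diff_left)

lemmas form_simps =
  form_add_left form_scale_left form_uminus_left form_diff_left
  form_add_right form_scale_right form_uminus_right form_diff_right

lemma scale_two: "s 2 x = x + x"
  using scale_left_distrib[of 1 1] by simp

text \<open>The Cartan integer \<open>m\<close> enters through a linear equation instead of a
  quotient; each use supplies \<open>m\<close> and leaves a bilinear identity to
  simplification.\<close>

lemma reflect:
  assumes "\<alpha> \<in> R" "\<beta> \<in> R" "B \<alpha> \<alpha> \<noteq> 0" "2 * B \<alpha> \<beta> = m * B \<alpha> \<alpha>"
  shows "\<beta> - s m \<alpha> \<in> R"
proof -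
  have "2 * B \<alpha> \<beta> / B \<alpha> \<alpha> = m"
    using assms(3,4) by (simp add: field_simps)
  then have "reflection s B \<alpha> \<beta> = \<beta> - s m \<alpha>"
    by (simp add: reflection_def)
  then show ?thesis
    using reflection_closed[OF assms(1,3)] assms(2) by (metis image_subset_iff)
qed

text \<open>
  A lift \<open>e\<close> of one short root and lifts \<open>a i\<close> of the differences with the others determine the
  remaining lifts, because \<open>e - a i\<close> is the reflection of \<open>e\<close> in \<open>a i\<close>.
\<close>

lemma adapted_lift_exists:
  "\<exists>\<epsilon>. \<forall>i. q (\<epsilon> i) = std_basis i \<and> \<epsilon> i \<in> R \<and> (\<forall>j. i \<noteq> j \<longrightarrow> \<epsilon> i - \<epsilon> j \<in> R)"
proof -
  define o' :: 'n where "o' = undefined"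
  have "std_basis o' \<in> q ` R"
    unfolding image_q BC_def short_roots_def by blast
  then obtain e where e: "e \<in> R" "q e = std_basis o'"
    by auto
  have "\<exists>a\<in>R. q a = std_basis o' - std_basis i" if "o' \<noteq> i" for i
  proof -
    have "std_basis o' - std_basis i \<in> q ` R"
      unfolding image_q BC_def middle_roots_def using that by blast
    then show ?thesis by auto
  qed
  then obtain a where a: "\<And>i. o' \<noteq> i \<Longrightarrow> a i \<in> R"
    "\<And>i. o' \<noteq> i \<Longrightarrow> q (a i) = std_basis o' - std_basis i"
    by metis
  define \<epsilon> where "\<epsilon> i = (if i = o' then e else e - a i)" for i
  have basis: "std_form (std_basis i :: complex ^ 'n) (std_basis j) = (if i = j then 1 else 0)" for i j
    by (simp add: std_form_std_basis std_basis_nth)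
  have [simp]: "std_form (x - y) z = std_form x z - std_form y z"
    "std_form z (x - y) = std_form z x - std_form z y" for x y z :: "complex ^ 'n"
    by (simp_all add: std_form_def algebra_simps sum_subtractf)
  have Baa: "B (a i) (a i) = 2" "B (a i) e = 1" if "o' \<noteq> i" for i
    using that e by (simp_all add: form_eq a basis)
  have Bab: "B (a i) (a j) = 1" if "o' \<noteq> i" "o' \<noteq> j" "i \<noteq> j" for i j
    using that by (simp add: form_eq a basis)
  have "q (\<epsilon> i) = std_basis i" for i
    using a(2)[of i] e by (simp add: \<epsilon>_def q_diff)
  moreover have "\<epsilon> i \<in> R" for i
    using reflect[of "a i" e 1] a(1)[of i] e(1) Baa[of i] by (auto simp: \<epsilon>_def)
  moreover have "\<epsilon> i - \<epsilon> j \<in> R" if "i \<noteq> j" for i j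
  proof -
    consider "i = o'" | "j = o'" "i \<noteq> o'" | "i \<noteq> o'" "j \<noteq> o'" by blast
    then show ?thesis
    proof cases
      case 1
      then show ?thesis using that a(1)[of j] by (simp add: \<epsilon>_def)
    next
      \<comment> \<open>The difference is \<open>- a i\<close>, the image of \<open>a i\<close>
        under its own reflection; in the third case it is \<open>a j - a i\<close>, the image of
        \<open>a j\<close> under the reflection in \<open>a i\<close>.\<close>
      case 2
      then show ?thesis
        using reflect[of "a i" "a i" 2] a(1)[of i] Baa[of i] by (simp add: \<epsilon>_def scale_two)
    next
      case 3
      then show ?thesis
        using that reflect[of "a i" "a j" 1] a(1)[of i] a(1)[of j] Baa[of i] Bab[of i j]
        by (simp add: \<epsilon>_def)
    qed
  qed
  ultimately show ?thesis by blast
qed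

end

section \<open>Lifts of the short roots and the orthogonal splitting\<close>

locale BC_lift = BC_cover s B R q
  for s :: "complex \<Rightarrow> 'v::ab_group_add \<Rightarrow> 'v" and B :: "'v \<Rightarrow> 'v \<Rightarrow> complex" and R :: "'v set"
    and q :: "'v \<Rightarrow> complex ^ 'n::finite" +
  fixes \<epsilon> :: "'n \<Rightarrow> 'v"
  assumes q_lift: "q (\<epsilon> i) = std_basis i"
    and lift_in: "\<epsilon> i \<in> R"
    and diff_lift_in: "i \<noteq> j \<Longrightarrow> \<epsilon> i - \<epsilon> j \<in> R"
begin

definition K :: "'v set" where "K = {v. q v = 0}"

lemma form_ker_eq: "form_ker B = K"
proof (intro subset_antisym subsetI)
  fix v assume "v \<in> form_ker B"
  then have "B v (\<epsilon> i) = 0" for i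
    by (simp add: form_ker_def)
  then show "v \<in> K"
    by (simp add: form_eq q_lift std_form_std_basis K_def vec_eq_iff)
next
  fix v assume "v \<in> K"
  then show "v \<in> form_ker B"
    by (simp add: form_ker_def form_eq K_def std_form_def)
qed

lemma subspace_K: "subspace K"
  by (intro subspaceI) (simp_all add: K_def q_zero q_add q_scale)

lemma form_K: "h \<in> K \<Longrightarrow> B h x = 0" "h \<in> K \<Longrightarrow> B x h = 0"
  by (simp_all add: K_def form_eq std_form_def)

lemma form_lift: "B (\<epsilon> i) (\<epsilon> j) = (if i = j then 1 else 0)"
  by (simp add: form_eq q_lift std_form_std_basis std_basis_nth)

text \<open>Thus \<open>q\<close> is injective on the span of the lifts, which makes the splitting
  direct and later removes the component of a kernel vector in that span.\<close>

lemma q_in_span_lift: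
  assumes "x \<in> span (range \<epsilon>)"
  shows "x = (\<Sum>i\<in>UNIV. s (q x $ i) (\<epsilon> i))"
  using assms
proof (induction rule: span_induct_alt)
  case base
  then show ?case by (simp add: q_zero)
next
  case (step c x y)
  then obtain j where j: "x = \<epsilon> j" by blast
  have "(\<Sum>i\<in>UNIV. s (q (s c x + y) $ i) (\<epsilon> i)) =
      (\<Sum>i\<in>UNIV. (if j = i then s c (\<epsilon> j) else 0) + s (q y $ i) (\<epsilon> i))"
    by (rule sum.cong) (auto simp: j q_add q_scale q_lift std_basis_nth scale_left_distrib)
  also have "\<dots> = s c x + y"
    using step.IH by (simp add: sum.distrib j)
  finally show ?case by simp
qed

lemma orthonormal_splitting_lift: "orthonormal_splitting s B \<epsilon>"
proof -
  have "v \<in> span (range \<epsilon>) + K" for v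
  proof -
    let ?x = "\<Sum>i\<in>UNIV. s (q v $ i) (\<epsilon> i)"
    have q_sum: "q (sum f I) = (\<Sum>i\<in>I. q (f i))" for f :: "'n \<Rightarrow> 'v" and I
      by (induction I rule: infinite_finite_induct) (simp_all add: q_zero q_add)
    have "q ?x $ j = (\<Sum>i\<in>UNIV. if i = j then q v $ i else 0)" for j
      unfolding q_sum sum_component
      by (rule sum.cong) (auto simp: q_scale q_lift std_basis_nth)
    then have "v - ?x \<in> K"
      by (simp add: K_def q_diff vec_eq_iff)
    moreover have "?x \<in> span (range \<epsilon>)"
      by (intro span_sum span_scale span_base) auto
    ultimately have "?x + (v - ?x) \<in> span (range \<epsilon>) + K"
      by (intro set_plus_intro)
    then show ?thesis by simp
  qed
  moreover have "span (range \<epsilon>) \<inter> K = {0}"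
    using q_in_span_lift by (fastforce simp: K_def q_zero span_zero)
  ultimately show ?thesis
    unfolding orthonormal_splitting_def form_ker_eq by (simp add: form_lift set_eq_iff)
qed

section \<open>Shifts are the same for roots of equal length\<close>

lemma reflect_shift:
  assumes "\<alpha> + h \<in> R" "\<beta> + h' \<in> R" "h \<in> K" "h' \<in> K"
    and "B \<alpha> \<alpha> \<noteq> 0" "2 * B \<alpha> \<beta> = m * B \<alpha> \<alpha>" "\<gamma> = \<beta> - s m \<alpha>"
  shows "\<gamma> + (h' - s m h) \<in> R"
proof -
  \<comment> \<open>Kernel elements do not affect the form, so the shifted roots have the Cartan
    integer of the unshifted ones.\<close>
  have "\<beta> + h' - s m (\<alpha> + h) \<in> R"
    using assms by (intro reflect) (simp_all add: form_simps form_K)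
  then show ?thesis
    by (simp add: assms(7) algebra_simps)
qed

lemma reflect_fixed:
  assumes "\<beta> + h \<in> R" "h \<in> K" "\<alpha> \<in> R"
    and "B \<alpha> \<alpha> \<noteq> 0" "2 * B \<alpha> \<beta> = m * B \<alpha> \<alpha>" "\<gamma> = \<beta> - s m \<alpha>"
  shows "\<gamma> + h \<in> R"
  using reflect_shift[of \<alpha> 0 \<beta> h m \<gamma>] assms by (simp add: K_def q_zero)

text \<open>Signs change by the reflections in \<open>\<epsilon> i\<close>, indices by those in
  \<open>\<epsilon> i - \<epsilon> j\<close>. The lifts were chosen with all these mirrors in
  \<open>R\<close>; the two lemmas on the other lengths use the same mirrors.\<close>

lemma short_roots_conj:
  assumes h: "h \<in> K" and "\<alpha> \<in> short_roots \<epsilon>" "\<alpha> + h \<in> R" "\<beta> \<in> short_roots \<epsilon>"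
  shows "\<beta> + h \<in> R"
proof -
  have neg: "- \<epsilon> i + h \<in> R" if "\<epsilon> i + h \<in> R" for i
    by (rule reflect_fixed[OF that h lift_in[of i], where m = 2]) (simp_all add: form_lift scale_two)
  have pos: "\<epsilon> i + h \<in> R" if "- \<epsilon> i + h \<in> R" for i
    by (rule reflect_fixed[OF that h lift_in[of i], where m = "-2"])
      (simp_all add: form_lift scale_two form_simps)
  have move: "\<epsilon> j + h \<in> R" if "\<epsilon> i + h \<in> R" for i j
  proof (cases "i = j")
    case False
    then show ?thesis
      by (intro reflect_fixed[OF that h diff_lift_in[OF False], where m = 1])
        (simp_all add: form_lift form_simps)
  qed (use that in simp)
  show ?thesis
    using assms(2-4) neg pos move unfolding short_roots_def by fast
qed

lemma long_roots_conj:
  assumes h: "h \<in> K" and "\<alpha> \<in> long_roots s \<epsilon>" "\<alpha> + h \<in> R" "\<beta> \<in> long_roots s \<epsilon>"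
  shows "\<beta> + h \<in> R"
proof -
  have neg: "- s 2 (\<epsilon> i) + h \<in> R" if "s 2 (\<epsilon> i) + h \<in> R" for i
    by (rule reflect_fixed[OF that h lift_in[of i], where m = 4])
      (simp_all add: form_lift form_simps flip: scale_left_diff_distrib)
  have pos: "s 2 (\<epsilon> i) + h \<in> R" if "- s 2 (\<epsilon> i) + h \<in> R" for i
    by (rule reflect_fixed[OF that h lift_in[of i], where m = "-4"])
      (simp_all add: form_lift form_simps flip: scale_left_diff_distrib)
  have move: "s 2 (\<epsilon> j) + h \<in> R" if "s 2 (\<epsilon> i) + h \<in> R" for i j
  proof (cases "i = j")
    case False
    then show ?thesis
      by (intro reflect_fixed[OF that h diff_lift_in[OF False], where m = 2])
        (simp_all add: form_lift form_simps scale_right_diff_distrib)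
  qed (use that in simp)
  show ?thesis
    using assms(2-4) neg pos move unfolding long_roots_def by fast
qed

text \<open>Writing the signs as scalars lets one argument handle all four kinds of roots.\<close>

lemma middle_roots_eq:
  "middle_roots \<epsilon> = {s \<sigma> (\<epsilon> i) + s \<tau> (\<epsilon> j) | \<sigma> \<tau> i j. \<sigma> \<in> {1, -1} \<and> \<tau> \<in> {1, -1} \<and> i \<noteq> j}"
  unfolding middle_roots_def by (auto; force)

lemma middle_roots_conj:
  assumes h: "h \<in> K" and "\<alpha> \<in> middle_roots \<epsilon>" "\<alpha> + h \<in> R" "\<beta> \<in> middle_roots \<epsilon>"
  shows "\<beta> + h \<in> R"
proof -
  define P where "P \<sigma> i \<tau> j \<longleftrightarrow> s \<sigma> (\<epsilon> i) + s \<tau> (\<epsilon> j) + h \<in> R" for \<sigma> i \<tau> j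
  have swap: "P \<tau> j \<sigma> i" if "P \<sigma> i \<tau> j" for \<sigma> i \<tau> j
    using that by (simp add: P_def add_ac)
  have flip: "P (- \<sigma>) i \<tau> j" if "P \<sigma> i \<tau> j" "i \<noteq> j" for \<sigma> i \<tau> j
    unfolding P_def using that(2)
    by (intro reflect_fixed[OF that(1)[unfolded P_def] h lift_in[of i], where m = "2 * \<sigma>"])
      (simp_all add: form_lift form_simps scale_two flip: scale_scale)
  have move: "P \<sigma> k \<tau> j" if "P \<sigma> i \<tau> j" "i \<noteq> j" "k \<noteq> j" for \<sigma> i \<tau> j k
  proof (cases "i = k")
    case False
    then show ?thesis
      unfolding P_def using that(2,3)
      by (intro reflect_fixed[OF that(1)[unfolded P_def] h diff_lift_in[OF False], where m = \<sigma>])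
        (simp_all add: form_lift form_simps scale_right_diff_distrib)
  qed (use that in simp)
  \<comment> \<open>The indices move one at a time and must stay distinct in between. If
    \<open>i = l\<close>, it is \<open>j\<close> that moves to \<open>k\<close>, which leaves the
    signs attached in exchanged order; hence the disjunction.\<close>
  have indices: "P \<sigma> k \<tau> l \<or> P \<tau> k \<sigma> l" if "P \<sigma> i \<tau> j" "i \<noteq> j" "k \<noteq> l" for \<sigma> i \<tau> j k l
  proof (cases "i = l")
    case True
    then show ?thesis
      using move[OF swap[OF that(1)], of k] that by auto
  next
    case False
    then have "P \<tau> l \<sigma> i"
      using move[OF swap[OF that(1)], of l] that by auto
    then show ?thesis
      using move[OF swap, of \<tau> l \<sigma> i k] False that by auto
  qed
  obtain \<sigma> \<tau> i j where 1: "\<sigma> \<in> {1, -1}" "\<tau> \<in> {1, -1}" "i \<noteq> j" "P \<sigma> i \<tau> j"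
    using assms(2,3) unfolding middle_roots_eq P_def by blast
  obtain \<sigma>' \<tau>' k l where 2: "\<sigma>' \<in> {1, -1}" "\<tau>' \<in> {1, -1}" "k \<noteq> l"
    and \<beta>: "\<beta> = s \<sigma>' (\<epsilon> k) + s \<tau>' (\<epsilon> l)"
    using assms(4) unfolding middle_roots_eq by blast
  obtain \<mu> \<nu> where 3: "\<mu> \<in> {1, -1}" "\<nu> \<in> {1, -1}" "P \<mu> k \<nu> l"
    using indices[OF 1(4,3) 2(3)] 1(1,2) by blast
  \<comment> \<open>\<open>flip\<close> acts on the first entry only, so the second sign is
    corrected between two uses of \<open>swap\<close>.\<close>
  have 4: "P \<sigma>' k \<nu> l"
    using 3 2(1) flip[OF 3(3) 2(3)] by auto
  then have "P (- \<nu>) l \<sigma>' k"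
    using flip[OF swap[OF 4]] 2(3) by simp
  then have "P \<sigma>' k (- \<nu>) l"
    by (rule swap)
  with 4 have "P \<sigma>' k \<tau>' l"
    using 3(2) 2(2) by auto
  then show ?thesis
    unfolding P_def \<beta> .
qed

section \<open>The shift sets and the decomposition of the root set\<close>

definition shifts :: "'v set \<Rightarrow> 'v set" where
  "shifts \<Phi> = {h \<in> K. \<forall>\<alpha>\<in>\<Phi>. \<alpha> + h \<in> R}"

abbreviation H1 :: "'v set" where "H1 \<equiv> shifts (short_roots \<epsilon>)"
abbreviation H2 :: "'v set" where "H2 \<equiv> shifts (long_roots s \<epsilon>)"

text \<open>For \<open>n = 1\<close> there are no middle roots and \<open>H3\<close> is the whole kernel.\<close>

abbreviation H3 :: "'v set" where "H3 \<equiv> shifts (middle_roots \<epsilon>)"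

lemma shifts_subset_K: "shifts \<Phi> \<subseteq> K"
  by (auto simp: shifts_def)

lemma shifts_root: "h \<in> shifts \<Phi> \<Longrightarrow> \<alpha> \<in> \<Phi> \<Longrightarrow> \<alpha> + h \<in> R"
  by (simp add: shifts_def)

text \<open>\<open>shifts\<close> asks for every root of \<open>\<Phi>\<close>; by conjugacy a
  single one suffices.\<close>

lemma shiftsI:
  assumes "\<Phi> \<in> {short_roots \<epsilon>, long_roots s \<epsilon>, middle_roots \<epsilon>}"
    and "\<alpha> \<in> \<Phi>" "h \<in> K" "\<alpha> + h \<in> R"
  shows "h \<in> shifts \<Phi>"
  using assms short_roots_conj[of h] long_roots_conj[of h] middle_roots_conj[of h]
  unfolding shifts_def by blast

text \<open>One triple of representatives thus proves a relation between whole shift sets.\<close>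

lemma shifts_reflect:
  assumes "\<alpha> \<in> \<Phi>" "\<beta> \<in> \<Psi>" "\<gamma> \<in> X" "h \<in> shifts \<Phi>" "h' \<in> shifts \<Psi>"
    and X: "X \<in> {short_roots \<epsilon>, long_roots s \<epsilon>, middle_roots \<epsilon>}"
    and "B \<alpha> \<alpha> \<noteq> 0" "2 * B \<alpha> \<beta> = m * B \<alpha> \<alpha>" "\<gamma> = \<beta> - s m \<alpha>"
  shows "h' - s m h \<in> shifts X"
proof -
  have hK: "h \<in> K" "h' \<in> K"
    using assms(4,5) shifts_subset_K by blast+
  then have "h' - s m h \<in> K"
    by (intro subspace_diff subspace_scale subspace_K)
  moreover have "\<gamma> + (h' - s m h) \<in> R"
    using assms hK by (intro reflect_shift[of \<alpha> h \<beta>]) (simp_all add: shifts_root)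
  ultimately show ?thesis
    using shiftsI[OF X assms(3)] by blast
qed

lemma root_decomposition:
  "R = (short_roots \<epsilon> + H1) \<union> (long_roots s \<epsilon> + H2) \<union> (middle_roots \<epsilon> + H3)"
proof
  show "(short_roots \<epsilon> + H1) \<union> (long_roots s \<epsilon> + H2) \<union> (middle_roots \<epsilon> + H3) \<subseteq> R"
    by (auto simp: set_plus_def shifts_root)
  have q_short: "q ` short_roots \<epsilon> = short_roots std_basis"
    by (simp add: short_roots_def image_UN q_uminus q_lift)
  have q_long: "q ` long_roots s \<epsilon> = long_roots (*s) std_basis"
    by (simp add: long_roots_def image_UN q_uminus q_scale q_lift)
  have q_middle: "q ` middle_roots \<epsilon> = middle_roots std_basis"
    by (simp add: middle_roots_def image_UN q_uminus q_add q_diff q_lift)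
  show "R \<subseteq> (short_roots \<epsilon> + H1) \<union> (long_roots s \<epsilon> + H2) \<union> (middle_roots \<epsilon> + H3)"
  proof
    fix r assume r: "r \<in> R"
    then have "q r \<in> q ` short_roots \<epsilon> \<union> q ` long_roots s \<epsilon> \<union> q ` middle_roots \<epsilon>"
      unfolding q_short q_long q_middle BC_def[symmetric] image_q[symmetric] by blast
    then obtain \<alpha> where \<alpha>: "q r = q \<alpha>"
      "\<alpha> \<in> short_roots \<epsilon> \<or> \<alpha> \<in> long_roots s \<epsilon> \<or> \<alpha> \<in> middle_roots \<epsilon>"
      by blast
    define h where "h = r - \<alpha>"
    have h: "h \<in> K" "r = \<alpha> + h"
      using \<alpha>(1) by (simp_all add: h_def K_def q_diff)
    have "\<alpha> + h \<in> R"
      using r h(2) by simp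
    then have "\<alpha> \<in> short_roots \<epsilon> \<and> h \<in> H1 \<or> \<alpha> \<in> long_roots s \<epsilon> \<and> h \<in> H2 \<or>
        \<alpha> \<in> middle_roots \<epsilon> \<and> h \<in> H3"
      using \<alpha>(2) shiftsI[OF _ _ h(1)] by blast
    then show "r \<in> (short_roots \<epsilon> + H1) \<union> (long_roots s \<epsilon> + H2) \<union> (middle_roots \<epsilon> + H3)"
      unfolding h(2) by (auto intro: set_plus_intro)
  qed
qed

lemma short_in: "\<epsilon> i \<in> short_roots \<epsilon>" "- \<epsilon> i \<in> short_roots \<epsilon>"
  by (auto simp: short_roots_def)

lemma long_in: "s 2 (\<epsilon> i) \<in> long_roots s \<epsilon>" "- s 2 (\<epsilon> i) \<in> long_roots s \<epsilon>"
  by (auto simp: long_roots_def)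

lemma middle_in:
  assumes "i \<noteq> j"
  shows "\<epsilon> i + \<epsilon> j \<in> middle_roots \<epsilon>" "\<epsilon> i - \<epsilon> j \<in> middle_roots \<epsilon>"
    "- \<epsilon> i + \<epsilon> j \<in> middle_roots \<epsilon>" "- \<epsilon> i - \<epsilon> j \<in> middle_roots \<epsilon>"
  using assms unfolding middle_roots_def by blast+

lemma zero_in_H1: "0 \<in> H1"
  using shiftsI[of "short_roots \<epsilon>" "\<epsilon> undefined" 0] lift_in short_in by (simp add: K_def q_zero)

lemma zero_in_H3: "0 \<in> H3"
proof (cases "middle_roots \<epsilon> = {}")
  case True
  then show ?thesis
    by (simp add: shifts_def K_def q_zero)
next
  case False
  then obtain i j :: 'n where ij: "i \<noteq> j"
    unfolding middle_roots_def by blast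
  show ?thesis
    using diff_lift_in[OF ij] by (intro shiftsI[OF _ middle_in(2)[OF ij]]) (simp_all add: K_def q_zero)
qed

text \<open>\<open>s 2 (\<epsilon> i)\<close> need not be a root, so 0 cannot serve as the witness;
  but some root lies over its image under \<open>q\<close>.\<close>

lemma H2_nonempty: "H2 \<noteq> {}"
proof -
  define i :: 'n where "i = undefined"
  have "q (s 2 (\<epsilon> i)) \<in> q ` R"
    unfolding image_q BC_def long_roots_def q_scale q_lift by blast
  then obtain r where r: "r \<in> R" "q r = q (s 2 (\<epsilon> i))"
    by (metis imageE)
  then have "r - s 2 (\<epsilon> i) \<in> H2"
    by (intro shiftsI[of _ "s 2 (\<epsilon> i)"]) (auto simp: long_in K_def q_diff)
  then show ?thesis by blast
qed

section \<open>Relations between shift sets given by single reflections\<close>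

lemma scale_four: "s 4 x = x + x + x + x"
  using scale_left_distrib[of 2 2 x] by (simp add: scale_two add_ac)

lemmas reflect_simps = form_lift form_simps scale_two scale_four scale_right_distrib
  scale_right_diff_distrib

text \<open>In this name and the similar ones below, the first set belongs to the mirror, and the
  scalar is the Cartan integer. Even \<open>s 1\<close> is kept, to match the shape
  \<open>a - s c h\<close> in \<open>add_multiple_of_group_closure\<close>.\<close>

lemma H1_reflect_H1: "h \<in> H1 \<Longrightarrow> h' \<in> H1 \<Longrightarrow> h' - s 2 h \<in> H1"
  by (erule (1) shifts_reflect[OF short_in(1)[of undefined] short_in(1)[of undefined] short_in(2)[of undefined]])
    (simp_all add: reflect_simps)

lemma H2_reflect_H1: "h \<in> H2 \<Longrightarrow> h' \<in> H1 \<Longrightarrow> h' - s 1 h \<in> H1"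
  by (erule (1) shifts_reflect[OF long_in(1)[of undefined] short_in(1)[of undefined] short_in(2)[of undefined]])
    (simp_all add: reflect_simps)

lemma H1_reflect_H2: "h \<in> H1 \<Longrightarrow> h' \<in> H2 \<Longrightarrow> h' - s 4 h \<in> H2"
  by (erule (1) shifts_reflect[OF short_in(1)[of undefined] long_in(1)[of undefined] long_in(2)[of undefined]])
    (simp_all add: reflect_simps)

lemma H2_reflect_H2: "h \<in> H2 \<Longrightarrow> h' \<in> H2 \<Longrightarrow> h' - s 2 h \<in> H2"
  by (erule (1) shifts_reflect[OF long_in(1)[of undefined] long_in(1)[of undefined] long_in(2)[of undefined]])
    (simp_all add: reflect_simps)

lemma H1_reflect_H3:
  fixes i j :: 'n
  assumes "i \<noteq> j" "h \<in> H1" "h' \<in> H3"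
  shows "h' - s 2 h \<in> H3"
  by (rule shifts_reflect[OF short_in(1)[of i] middle_in(1)[of i j] middle_in(3)[of i j]])
    (use assms in \<open>simp_all add: reflect_simps\<close>)

lemma H3_reflect_H1:
  fixes i j :: 'n
  assumes "i \<noteq> j" "h \<in> H3" "h' \<in> H1"
  shows "h' - s 1 h \<in> H1"
  by (rule shifts_reflect[OF middle_in(1)[of i j] short_in(1)[of i] short_in(2)[of j]])
    (use assms in \<open>simp_all add: reflect_simps\<close>)

lemma H2_reflect_H3:
  fixes i j :: 'n
  assumes "i \<noteq> j" "h \<in> H2" "h' \<in> H3"
  shows "h' - s 1 h \<in> H3"
  by (rule shifts_reflect[OF long_in(1)[of i] middle_in(1)[of i j] middle_in(3)[of i j]])
    (use assms in \<open>simp_all add: reflect_simps\<close>)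

lemma H3_reflect_H2:
  fixes i j :: 'n
  assumes "i \<noteq> j" "h \<in> H3" "h' \<in> H2"
  shows "h' - s 2 h \<in> H2"
  by (rule shifts_reflect[OF middle_in(1)[of i j] long_in(1)[of i] long_in(2)[of j]])
    (use assms in \<open>simp_all add: reflect_simps\<close>)

text \<open>Middle roots sharing exactly one index have Cartan integer 1 or -1. With only two
  indices, middle roots are orthogonal or proportional, and \<open>H3\<close> need not be a
  group.\<close>

lemma H3_reflect_H3:
  fixes i j k :: 'n
  assumes "i \<noteq> j" "i \<noteq> k" "j \<noteq> k" "h \<in> H3" "h' \<in> H3"
  shows "h' - s 1 h \<in> H3"
  by (rule shifts_reflect[OF middle_in(2)[of i j] middle_in(2)[of i k] middle_in(2)[of j k]])
    (use assms in \<open>simp_all add: reflect_simps\<close>)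

text \<open>A root reflected in itself has Cartan integer 2, and \<open>h - s 2 h\<close> is
  \<open>- h\<close>.\<close>

lemma uminus_H1: "h \<in> H1 \<Longrightarrow> - h \<in> H1"
  using H1_reflect_H1[of h h] by (simp add: scale_two)

lemma uminus_H2: "h \<in> H2 \<Longrightarrow> - h \<in> H2"
  using H2_reflect_H2[of h h] by (simp add: scale_two)

lemma uminus_H3:
  assumes h: "h \<in> H3"
  shows "- h \<in> H3"
proof (cases "middle_roots \<epsilon> = {}")
  case True
  then show ?thesis
    using h subspace_neg[OF subspace_K] by (simp add: shifts_def)
next
  case False
  then obtain i j :: 'n where ij: "i \<noteq> j"
    unfolding middle_roots_def by blast
  have "h - s 2 h \<in> H3"
    by (rule shifts_reflect[OF middle_in(1)[OF ij] middle_in(1)[OF ij] middle_in(4)[OF ij] h h])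
      (use ij in \<open>simp_all add: reflect_simps\<close>)
  then show ?thesis
    by (simp add: scale_two)
qed

section \<open>Groups generated by shifts, and the span of the kernel\<close>

lemma subspace_imp_Z_subspace: "subspace T \<Longrightarrow> Z.subspace T"
  by (intro Z.subspaceI) (auto intro: subspace_0 subspace_add subspace_scale)

text \<open>All roots lie in the sum of the span of the lifts and \<open>span L\<close>, so this sum
  is the whole space, and a kernel vector has no component along the lifts. The alternative on
  \<open>middle_roots\<close> is needed because without middle roots \<open>H3\<close> is all of
  \<open>K\<close> and says nothing about \<open>R\<close>.\<close>

lemma span_eq_kernel:
  assumes span: "span (group_closure R) = UNIV"
    and L: "L \<subseteq> K" "H1 \<subseteq> span L" "H2 \<subseteq> span L"
    and mid: "middle_roots \<epsilon> = {} \<or> H3 \<subseteq> span L"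
  shows "span L = K"
proof
  show LK: "span L \<subseteq> K"
    using L(1) subspace_K by (rule span_minimal)
  let ?T = "{x + y | x y. x \<in> span (range \<epsilon>) \<and> y \<in> span L}"
  have T: "subspace ?T"
    by (intro subspace_sums subspace_span)
  have \<epsilon>: "\<epsilon> i \<in> span (range \<epsilon>)" for i
    by (rule span_base) simp
  have "short_roots \<epsilon> \<subseteq> span (range \<epsilon>)" "long_roots s \<epsilon> \<subseteq> span (range \<epsilon>)"
    "middle_roots \<epsilon> \<subseteq> span (range \<epsilon>)"
    unfolding short_roots_def long_roots_def middle_roots_def
    by (auto intro!: span_neg span_scale span_add span_diff \<epsilon>)
  then have "(short_roots \<epsilon> + H1) \<union> (long_roots s \<epsilon> + H2) \<union> (middle_roots \<epsilon> + H3) \<subseteq> ?T"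
    using L(2,3) mid unfolding set_plus_def by blast
  then have "R \<subseteq> ?T"
    by (simp only: root_decomposition[symmetric])
  moreover have "Z.subspace ?T"
    using T by (rule subspace_imp_Z_subspace)
  ultimately have "group_closure R \<subseteq> ?T"
    unfolding Z_span_eq_group_closure[symmetric] by (rule Z.span_minimal)
  then have "span (group_closure R) \<subseteq> ?T"
    using T by (rule span_minimal)
  then have T_UNIV: "?T = UNIV"
    unfolding span by (rule top.extremum_uniqueI)
  show "K \<subseteq> span L"
  proof
    fix v assume v: "v \<in> K"
    have "v \<in> ?T"
      unfolding T_UNIV by simp
    then obtain x y where xy: "v = x + y" "x \<in> span (range \<epsilon>)" "y \<in> span L"
      by blast
    have "q v = 0" "q y = 0"
      using v xy(3) LK by (auto simp: K_def)
    then have "q x = 0"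
      using xy(1) by (simp add: q_add)
    then have "x = 0"
      using q_in_span_lift[OF xy(2)] by simp
    then show "v \<in> span L"
      using xy by simp
  qed
qed

lemma Z_subspace_group_closure: "Z.subspace (group_closure X)"
  unfolding Z_span_eq_group_closure[symmetric] by simp

lemma group_closure_subset_K:
  assumes "X \<subseteq> K"
  shows "group_closure X \<subseteq> K"
  unfolding Z_span_eq_group_closure[symmetric]
  using assms subspace_imp_Z_subspace[OF subspace_K] by (rule Z.span_minimal)

lemma H1_subset_group_closure: "H1 \<subseteq> group_closure R"
proof
  fix h assume "h \<in> H1"
  then have "\<epsilon> undefined + h \<in> R"
    by (rule shifts_root[OF _ short_in(1)])
  then have "\<epsilon> undefined + h - \<epsilon> undefined \<in> group_closure R"
    using lift_in by (intro group_closure.diff group_closure.base) auto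
  then show "h \<in> group_closure R" by simp
qed

text \<open>A short root of shift 0, reflected in a long root of shift \<open>- h\<close>, acquires
  the shift \<open>h\<close>.\<close>

lemma H2_subset_H1: "H2 \<subseteq> H1"
proof
  fix h assume "h \<in> H2"
  then show "h \<in> H1"
    using H2_reflect_H1[OF uminus_H2 zero_in_H1] by fastforce
qed

lemma middle_roots_empty:
  assumes "CARD('n) = 1"
  shows "middle_roots \<epsilon> = {}"
proof -
  obtain e where "(UNIV :: 'n set) = {e}"
    using assms by (rule card_1_singletonE)
  then have "(i = j) = True" for i j :: 'n
    by (metis UNIV_I singletonD)
  then show ?thesis
    by (simp add: middle_roots_def)
qed

lemma add_multiple_of_group_closure:
  assumes step: "\<And>h a. h \<in> G \<Longrightarrow> a \<in> A \<Longrightarrow> a - s c h \<in> A"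
    and neg: "\<And>h. h \<in> G \<Longrightarrow> - h \<in> G"
    and x: "x \<in> group_closure G" and a: "a \<in> A"
  shows "a + s c x \<in> A"
proof -
  \<comment> \<open>Both signs and all \<open>a\<close> are needed at once, since the induction step
    subtracts \<open>y\<close> before adding \<open>x\<close>.\<close>
  have "\<forall>a\<in>A. a + s c x \<in> A \<and> a - s c x \<in> A"
    using x
  proof induction
    case (base x)
    show ?case
    proof (cases "x = 0")
      case False
      then have "x \<in> G" using base by simp
      then show ?thesis
        using step[of x] step[OF neg] by simp
    qed simp
  next
    case (diff x y)
    show ?case
    proof
      fix a assume "a \<in> A"
      then have "(a - s c y) + s c x \<in> A" "(a + s c y) - s c x \<in> A"
        using diff.IH by blast+
      then show "a + s c (x - y) \<in> A \<and> a - s c (x - y) \<in> A"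
        by (simp add: algebra_simps)
    qed
  qed
  then show ?thesis using a by blast
qed

text \<open>With one index every root is an integer multiple of \<open>\<epsilon> e\<close> plus an
  element of \<open>H1\<close>. \<open>q\<close> sees only the multiple, so membership in
  \<open>K\<close> forces it to be 0.\<close>

lemma group_closure_kernel_rank_one:
  assumes one: "CARD('n) = 1"
  shows "group_closure R \<inter> K = group_closure H1"
proof
  have HK: "group_closure H1 \<subseteq> K"
    by (intro group_closure_subset_K shifts_subset_K)
  moreover have "group_closure H1 \<subseteq> group_closure R"
    unfolding Z_span_eq_group_closure[of H1, symmetric]
    by (intro Z.span_minimal H1_subset_group_closure Z_subspace_group_closure)
  ultimately show "group_closure H1 \<subseteq> group_closure R \<inter> K" by blast
  obtain e where "(UNIV :: 'n set) = {e}"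
    using one by (rule card_1_singletonE)
  then have e: "i = e" for i
    by (metis UNIV_I singletonD)
  let ?T = "Z.span (insert (\<epsilon> e) H1)"
  have \<epsilon>: "\<epsilon> i \<in> ?T" for i
    using arg_cong[OF e[of i], of \<epsilon>] by (simp add: Z.span_base)
  have "short_roots \<epsilon> \<subseteq> T \<and> long_roots s \<epsilon> \<subseteq> T" if "Z.subspace T" "\<And>i. \<epsilon> i \<in> T" for T
    unfolding short_roots_def long_roots_def scale_two using that
    by (auto intro!: Z.subspace_neg Z.subspace_add Z.subspace_diff)
  then have "short_roots \<epsilon> \<subseteq> ?T" "long_roots s \<epsilon> \<subseteq> ?T"
    using \<epsilon> Z.subspace_span by blast+
  moreover have "H1 \<subseteq> ?T"
    by (auto intro: Z.span_base)
  moreover note middle_roots_empty[OF one]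
  ultimately have "(short_roots \<epsilon> + H1) \<union> (long_roots s \<epsilon> + H2) \<union> (middle_roots \<epsilon> + H3) \<subseteq> ?T"
    using H2_subset_H1 by (auto elim!: set_plus_elim intro!: Z.span_add)
  then have "R \<subseteq> ?T"
    by (simp only: root_decomposition[symmetric])
  then have "group_closure R \<subseteq> ?T"
    unfolding Z_span_eq_group_closure[symmetric] by (intro Z.span_minimal) auto
  moreover have "x \<in> group_closure H1" if x: "x \<in> K" "x \<in> ?T" for x
  proof -
    obtain m where m: "x - s (of_int m) (\<epsilon> e) \<in> Z.span H1"
      using x(2) Z.span_breakdown_eq by blast
    then have "x - s (of_int m) (\<epsilon> e) \<in> K"
      using HK unfolding Z_span_eq_group_closure by blast
    then have "of_int m *s std_basis e = (0 :: complex ^ 'n)"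
      using x(1) by (simp add: K_def q_diff q_scale q_lift)
    then have "(of_int m *s std_basis e :: complex ^ 'n) $ e = (0 :: complex ^ 'n) $ e"
      by (rule arg_cong)
    then have "m = 0"
      by (simp add: std_basis_nth)
    then show ?thesis
      using m by (simp add: Z_span_eq_group_closure)
  qed
  ultimately show "group_closure R \<inter> K \<subseteq> group_closure H1" by blast
qed

end

lemma quotient_map_F2_zero:
  assumes "quotient_map_F2 A A' k \<phi>" "0 \<in> A'"
  shows "\<phi> 0 = 0"
  using assms unfolding quotient_map_F2_def by blast

text \<open>Doubling carries half of \<open>L\<close> onto \<open>L\<close>, and \<open>L\<close>
  onto twice \<open>L\<close>, so one identification serves both quotients.\<close>

lemma (in complex_space) quotient_map_F2_half:
  assumes \<phi>: "quotient_map_F2 L (s 2 ` L) k \<phi>" and L: "Z.subspace L"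
  shows "quotient_map_F2 (s (1/2) ` L) L k (\<lambda>x. \<phi> (s 2 x))"
proof -
  have "\<phi> ` L = F2 k"
    using \<phi> unfolding quotient_map_F2_def by (rule conjunct1)
  then have "(\<lambda>x. \<phi> (s 2 x)) ` s (1/2) ` L = F2 k"
    by (simp add: image_image)
  moreover have "\<phi> (s 2 (x + y)) = \<phi> (s 2 x) + \<phi> (s 2 y)" if "x \<in> s (1/2) ` L" "y \<in> s (1/2) ` L" for x y
    using \<phi> that unfolding quotient_map_F2_def by (auto simp: scale_right_distrib)
  moreover have "{x \<in> s (1/2) ` L. \<phi> (s 2 x) = 0} = L"
  proof (intro subset_antisym subsetI)
    fix x assume "x \<in> {x \<in> s (1/2) ` L. \<phi> (s 2 x) = 0}"
    then obtain y where y: "y \<in> L" "x = s (1/2) y" "\<phi> y = 0"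
      by auto
    then have "y \<in> s 2 ` L"
      using \<phi> unfolding quotient_map_F2_def by blast
    then show "x \<in> L"
      using y(2) by auto
  next
    fix x assume x: "x \<in> L"
    then have "s 2 x \<in> s 2 ` L" by blast
    then have "s 2 x \<in> L" "\<phi> (s 2 x) = 0"
      using \<phi> unfolding quotient_map_F2_def by blast+
    moreover have "x = s (1/2) (s 2 x)"
      by simp
    ultimately show "x \<in> {x \<in> s (1/2) ` L. \<phi> (s 2 x) = 0}"
      by blast
  qed
  ultimately show ?thesis
    unfolding quotient_map_F2_def by (intro conjI ballI)
qed

lemma two_distinct_indices:
  assumes "CARD('n::finite) \<ge> 2"
  obtains i j :: "'n::finite" where "i \<noteq> j"
  using assms
  by (metis card_le_Suc0_iff_eq finite_class.finite_UNIV UNIV_I not_less_eq_eq numeral_2_eq_2)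

lemma three_distinct_indices:
  assumes "CARD('n::finite) > 2"
  obtains i j k :: "'n::finite" where "i \<noteq> j" "i \<noteq> k" "j \<noteq> k"
proof -
  have "CARD('n) \<ge> 3"
    using assms by simp
  then obtain T :: "'n set" where "card T = 3"
    using obtain_subset_with_card_n by metis
  then show ?thesis
    using that unfolding card_3_iff by blast
qed

section \<open>Rank of the lattice and the cases of the theorem\<close>

locale finitely_generated_BC_lift = BC_lift s B R q \<epsilon>
  for s :: "complex \<Rightarrow> 'v::ab_group_add \<Rightarrow> 'v" and B :: "'v \<Rightarrow> 'v \<Rightarrow> complex" and R :: "'v set"
    and q :: "'v \<Rightarrow> complex ^ 'n::finite" and \<epsilon> :: "'n \<Rightarrow> 'v" +
  assumes tensor_bij: "bij_betw (tensor_map s) (tensor_complex (group_closure R)) UNIV"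
    and finitely_generated: "\<exists>F. finite F \<and> group_closure F = group_closure R"
begin

lemma lattice_rank:
  assumes "Z.subspace L" "L \<subseteq> group_closure R" "L \<subseteq> K" "H1 \<subseteq> span L"
    and "middle_roots \<epsilon> = {} \<or> H3 \<subseteq> span L"
  shows "free_of_rank s L (dim K)"
proof -
  have "span L = K"
    using span_if_tensor_map_surj[OF tensor_bij] assms(3-5) H2_subset_H1
    by (intro span_eq_kernel) auto
  then show ?thesis
    using free_of_rank_dim[OF tensor_bij _ _ assms(1,2)] finitely_generated by blast
qed

text \<open>\<open>L\<close> is generated by \<open>H1\<close>. Reflections in short roots have
  Cartan integer 2 on short and 4 on long roots, so \<open>H1\<close> absorbs twice \<open>L\<close>
  and \<open>H2\<close> four times \<open>L\<close>; \<open>S\<close> contains a basis because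
  \<open>H1\<close> generates.\<close>

lemma case_one:
  assumes one: "CARD('n) = 1" and L: "L = group_closure R \<inter> K"
  shows "free_of_rank s L (dim K) \<and>
    (\<exists>\<iota>2 S. quotient_map_F2 L (s 2 ` L) (dim K) \<iota>2 \<and>
      S \<subseteq> F2 (dim K) \<and> 0 \<in> S \<and> (\<exists>T\<subseteq>S. F2_basis T (dim K)) \<and>
      H1 = {x \<in> L. \<iota>2 x \<in> S} \<and> H2 \<subseteq> {x \<in> L. \<iota>2 x \<in> S} \<and>
      H2 + s 4 ` L \<subseteq> H2 \<and> H2 + s 2 ` H2 \<subseteq> H2)"
proof -
  have L_eq: "L = group_closure H1"
    unfolding L by (rule group_closure_kernel_rank_one[OF one])
  have sub: "Z.subspace L"
    unfolding L_eq by (rule Z_subspace_group_closure)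
  have H1L: "H1 \<subseteq> L"
    unfolding L_eq by (auto intro: group_closure.base)
  have free: "free_of_rank s L (dim K)"
  proof (rule lattice_rank[OF sub])
    show "H1 \<subseteq> span L"
      using H1L span_superset by blast
  qed (use L middle_roots_empty[OF one] in auto)
  then obtain \<phi> where \<phi>: "quotient_map_F2 L (s 2 ` L) (dim K) \<phi>"
    using quotient_map_F2_exists by blast
  have cosets: "h + x \<in> H1" if "h \<in> H1" "x \<in> s 2 ` L" for h x
    using that add_multiple_of_group_closure[OF H1_reflect_H1 uminus_H1] unfolding L_eq by blast
  have sat: "\<phi> ` H1 \<subseteq> F2 (dim K)" "H1 = {x \<in> L. \<phi> x \<in> \<phi> ` H1}"
    by (rule quotient_map_F2_saturated[OF \<phi> Z.subspace_diff[OF sub] H1L cosets]; assumption)+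
  have "0 \<in> s 2 ` L"
    using Z.subspace_0[OF sub] by force
  then have "0 \<in> \<phi> ` H1"
    using quotient_map_F2_zero[OF \<phi>] zero_in_H1 by (metis imageI)
  moreover have "\<exists>T\<subseteq>\<phi> ` H1. F2_basis T (dim K)"
    using \<phi> L_eq[symmetric] by (rule F2_basis_in_image_of_generators)
  moreover have "H2 \<subseteq> {x \<in> L. \<phi> x \<in> \<phi> ` H1}"
    by (rule order.trans[OF H2_subset_H1 equalityD1[OF sat(2)]])
  moreover have "H2 + s 4 ` L \<subseteq> H2"
    using add_multiple_of_group_closure[OF H1_reflect_H2 uminus_H1]
    unfolding L_eq by (auto elim!: set_plus_elim)
  moreover have "H2 + s 2 ` H2 \<subseteq> H2"
    using H2_reflect_H2[OF uminus_H2] by (auto elim!: set_plus_elim)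
  ultimately show ?thesis
    using free \<phi> sat by - (rule conjI, assumption, rule exI[of _ \<phi>], rule exI[of _ "\<phi> ` H1"], intro conjI)
qed

text \<open>For this and the next two inclusions, a root of shift 0 is reflected in a mirror of
  shift \<open>- h\<close>, which adds the Cartan integer times \<open>h\<close>.\<close>

lemma H3_subset_H1:
  assumes "i \<noteq> (j :: 'n)"
  shows "H3 \<subseteq> H1"
proof
  fix h assume "h \<in> H3"
  then show "h \<in> H1"
    using H3_reflect_H1[OF assms uminus_H3 zero_in_H1] by fastforce
qed

lemma H2_subset_H3:
  assumes "i \<noteq> (j :: 'n)"
  shows "H2 \<subseteq> H3"
proof
  fix h assume "h \<in> H2"
  then show "h \<in> H3"
    using H2_reflect_H3[OF assms uminus_H2 zero_in_H3] by fastforce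
qed

lemma double_H1_subset_H3:
  assumes "i \<noteq> (j :: 'n)"
  shows "s 2 ` H1 \<subseteq> H3"
proof
  fix x assume "x \<in> s 2 ` H1"
  then obtain h where "h \<in> H1" "x = s 2 h" by blast
  then show "x \<in> H3"
    using H1_reflect_H3[OF assms uminus_H1 zero_in_H3] by fastforce
qed

text \<open>Reflections in middle roots have Cartan integer 1 on suitable short roots and 2 on
  suitable long ones, so \<open>H1\<close> absorbs \<open>L\<close> and \<open>H2\<close> absorbs
  twice \<open>L\<close>. \<open>H1\<close> lies in half of \<open>L\<close> because its doubles are
  in \<open>H3\<close>.\<close>

lemma case_at_least_two:
  assumes two: "CARD('n) \<ge> 2" and L: "L = group_closure H3"
  shows "free_of_rank s L (dim K) \<and>
    (\<exists>\<phi>1 \<phi>2 S1 S2.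
      quotient_map_F2 (s (1/2) ` L) L (dim K) \<phi>1 \<and> quotient_map_F2 L (s 2 ` L) (dim K) \<phi>2 \<and>
      S1 \<subseteq> F2 (dim K) \<and> S2 \<subseteq> F2 (dim K) \<and> 0 \<in> S1 \<and>
      H1 = {x \<in> s (1/2) ` L. \<phi>1 x \<in> S1} \<and> H2 = {x \<in> L. \<phi>2 x \<in> S2})"
proof -
  obtain i j :: 'n where ij: "i \<noteq> j"
    using two by (rule two_distinct_indices)
  have sub: "Z.subspace L"
    unfolding L by (rule Z_subspace_group_closure)
  have H3L: "H3 \<subseteq> L"
    unfolding L by (auto intro: group_closure.base)
  have H1L: "H1 \<subseteq> s (1/2) ` L"
  proof
    fix h assume "h \<in> H1"
    then have "s 2 h \<in> L"
      using double_H1_subset_H3[OF ij] H3L by blast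
    then have "s (1/2) (s 2 h) \<in> s (1/2) ` L" by (rule imageI)
    then show "h \<in> s (1/2) ` L" by simp
  qed
  have free: "free_of_rank s L (dim K)"
  proof (rule lattice_rank[OF sub])
    show "L \<subseteq> group_closure R"
      unfolding L Z_span_eq_group_closure[of H3, symmetric]
      using H3_subset_H1[OF ij] H1_subset_group_closure
      by (intro Z.span_minimal Z_subspace_group_closure) blast
    show "L \<subseteq> K"
      unfolding L by (intro group_closure_subset_K shifts_subset_K)
    show "H1 \<subseteq> span L"
      using H1L span_base span_scale by blast
    show "middle_roots \<epsilon> = {} \<or> H3 \<subseteq> span L"
      using H3L span_superset by blast
  qed
  then obtain \<phi>2 where \<phi>2: "quotient_map_F2 L (s 2 ` L) (dim K) \<phi>2"
    using quotient_map_F2_exists by blast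
  define \<phi>1 where "\<phi>1 = (\<lambda>x. \<phi>2 (s 2 x))"
  have \<phi>1: "quotient_map_F2 (s (1/2) ` L) L (dim K) \<phi>1"
    unfolding \<phi>1_def by (rule quotient_map_F2_half[OF \<phi>2 sub])
  have cosets1: "h + x \<in> H1" if "h \<in> H1" "x \<in> L" for h x
    using add_multiple_of_group_closure[OF H3_reflect_H1[OF ij] uminus_H3, of x h] that
    unfolding L by simp
  have cosets2: "h + x \<in> H2" if "h \<in> H2" "x \<in> s 2 ` L" for h x
    using that add_multiple_of_group_closure[OF H3_reflect_H2[OF ij] uminus_H3] unfolding L by blast
  have diff: "x - y \<in> s (1/2) ` L" if xy: "x \<in> s (1/2) ` L" "y \<in> s (1/2) ` L" for x y
  proof -
    obtain a b where ab: "a \<in> L" "b \<in> L" "x = s (1/2) a" "y = s (1/2) b"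
      using xy by blast
    then have "x - y = s (1/2) (a - b)"
      by (simp add: scale_right_diff_distrib)
    then show ?thesis
      using Z.subspace_diff[OF sub ab(1,2)] by blast
  qed
  have H2L: "H2 \<subseteq> L"
    using H2_subset_H3[OF ij] H3L by blast
  have sat1: "\<phi>1 ` H1 \<subseteq> F2 (dim K)" "H1 = {x \<in> s (1/2) ` L. \<phi>1 x \<in> \<phi>1 ` H1}"
    by (rule quotient_map_F2_saturated[OF \<phi>1 diff H1L cosets1]; assumption)+
  have sat2: "\<phi>2 ` H2 \<subseteq> F2 (dim K)" "H2 = {x \<in> L. \<phi>2 x \<in> \<phi>2 ` H2}"
    by (rule quotient_map_F2_saturated[OF \<phi>2 Z.subspace_diff[OF sub] H2L cosets2]; assumption)+
  have "0 \<in> \<phi>1 ` H1"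
    using quotient_map_F2_zero[OF \<phi>1 Z.subspace_0[OF sub]] zero_in_H1 by (metis imageI)
  then show ?thesis
    using free \<phi>1 \<phi>2 sat1 sat2
    by (intro conjI exI[of _ \<phi>1] exI[of _ \<phi>2] exI[of _ "\<phi>1 ` H1"] exI[of _ "\<phi>2 ` H2"])
qed

lemma case_at_least_three:
  assumes three: "CARD('n) > 2"
  shows "H3 = group_closure H3"
proof
  show "H3 \<subseteq> group_closure H3"
    by (auto intro: group_closure.base)
  obtain i j k :: 'n where ijk: "i \<noteq> j" "i \<noteq> k" "j \<noteq> k"
    using three by (rule three_distinct_indices)
  show "group_closure H3 \<subseteq> H3"
  proof
    fix x assume "x \<in> group_closure H3"
    then show "x \<in> H3"
    proof induction
      case (diff x y)
      then show ?case
        using H3_reflect_H3[OF ijk, of y x] by simp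
    qed (use zero_in_H3 in auto)
  qed
qed

lemma case_two:
  assumes two: "CARD('n) \<ge> 2" and L: "L = group_closure H3"
  shows "H3 \<subseteq> L \<and> 0 \<in> H3 \<and> (\<exists>X\<subseteq>H3. Z_basis s X L) \<and>
    H2 + H3 = s 2 ` H1 + H3 \<and> s 2 ` H1 + H3 \<subseteq> H3"
proof -
  obtain i j :: 'n where ij: "i \<noteq> j"
    using two by (rule two_distinct_indices)
  have H3L: "H3 \<subseteq> L"
    unfolding L by (auto intro: group_closure.base)
  obtain X where X: "finite X" "Z_basis s X L"
    using case_at_least_two[OF two L] unfolding free_of_rank_def by blast
  have basis: "\<exists>Y\<subseteq>H3. Z_basis s Y L"
  proof (rule basis_in_generating_union_of_cosets[OF X H3L])
    show "L \<subseteq> Z.span H3"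
      by (simp add: L Z_span_eq_group_closure)
    \<comment> \<open>Members of \<open>H3\<close> are also shifts of short roots, and these mirrors
      have Cartan integer 2 on middle roots; this gives closure under adding twice
      \<open>L\<close>.\<close>
    have "h' - s 2 h \<in> H3" if "h \<in> H3" "h' \<in> H3" for h h'
      using H1_reflect_H3[OF ij] H3_subset_H1[OF ij] that by blast
    then show "h + s 2 x \<in> H3" if "h \<in> H3" "x \<in> L" for h x
      using add_multiple_of_group_closure[OF _ uminus_H3] that unfolding L by blast
  qed
  have H2_add: "h + h' \<in> H3" if "h \<in> H2" "h' \<in> H3" for h h'
    using H2_reflect_H3[OF ij uminus_H2[OF that(1)] that(2)] by (simp add: add.commute)
  have sum2: "H2 + H3 = H3"
  proof (intro subset_antisym subsetI)
    fix x assume x: "x \<in> H3"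
    \<comment> \<open>As 0 may be missing from \<open>H2\<close>, any member of \<open>H2\<close> is
      added and subtracted instead.\<close>
    obtain h where h: "h \<in> H2"
      using H2_nonempty by blast
    have "h + (- h + x) \<in> H2 + H3"
      by (intro set_plus_intro h H2_add uminus_H2 x)
    then show "x \<in> H2 + H3" by simp
  qed (auto elim!: set_plus_elim intro: H2_add)
  have "s 2 h + h' \<in> H3" if "h \<in> H1" "h' \<in> H3" for h h'
    using H1_reflect_H3[OF ij uminus_H1[OF that(1)] that(2)] by (simp add: add.commute)
  moreover have "s 2 0 \<in> s 2 ` H1"
    using zero_in_H1 by (rule imageI)
  then have "x \<in> s 2 ` H1 + H3" if "x \<in> H3" for x
    using set_plus_intro[OF _ that, of "s 2 0"] by simp
  ultimately have sum1: "s 2 ` H1 + H3 = H3"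
    by (auto elim!: set_plus_elim)
  show ?thesis
    using H3L zero_in_H3 basis by (simp add: sum1 sum2)
qed

end

theorem mainTheorem6:
  fixes s :: "complex \<Rightarrow> 'v \<Rightarrow> 'v::ab_group_add"
    and B :: "'v \<Rightarrow> 'v \<Rightarrow> complex"
    and R :: "'v set"
    and k :: nat
  assumes GRRS: "GRRS s B R"
    and finitely_generated: "\<exists>F. finite F \<and> group_closure F = group_closure R"
    and cl: "cl_iso s B R (*s) std_form (BC :: (complex ^ 'n::finite) set)"
    and k: "k = vector_space.dim s (form_ker B)"
  shows "\<exists>B' R' (\<epsilon> :: 'n \<Rightarrow> 'v) H1 H2 H3.
     GRRS_iso s B R s B' R' \<and>
     orthonormal_splitting s B' \<epsilon> \<and>
     R' = (short_roots \<epsilon> + H1) \<union> (long_roots s \<epsilon> + H2) \<union> (middle_roots \<epsilon> + H3) \<and>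
     H1 \<subseteq> form_ker B' \<and> H2 \<subseteq> form_ker B' \<and> H3 \<subseteq> form_ker B' \<and>
     uminus ` H1 = H1 \<and> uminus ` H2 = H2 \<and> uminus ` H3 = H3 \<and>
     0 \<in> H1 \<and> 0 \<in> H3 \<and>
     (CARD('n) = 1 \<longrightarrow>
       (let L = group_closure R' \<inter> form_ker B' in
         free_of_rank s L k \<and>
         (\<exists>\<iota>2 S. quotient_map_F2 L (s 2 ` L) k \<iota>2 \<and>
            S \<subseteq> F2 k \<and> 0 \<in> S \<and> (\<exists>T\<subseteq>S. F2_basis T k) \<and>
            H1 = {x \<in> L. \<iota>2 x \<in> S} \<and>
            H2 \<subseteq> {x \<in> L. \<iota>2 x \<in> S} \<and>
            H2 + s 4 ` L \<subseteq> H2 \<and> H2 + s 2 ` H2 \<subseteq> H2))) \<and>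
     (CARD('n) > 2 \<longrightarrow>
       (let L = group_closure H3 in
         free_of_rank s L k \<and> H3 = L \<and>
         (\<exists>\<phi>1 \<phi>2 S1 S2.
            quotient_map_F2 (s (1/2) ` L) L k \<phi>1 \<and> quotient_map_F2 L (s 2 ` L) k \<phi>2 \<and>
            S1 \<subseteq> F2 k \<and> S2 \<subseteq> F2 k \<and> 0 \<in> S1 \<and>
            H1 = {x \<in> s (1/2) ` L. \<phi>1 x \<in> S1} \<and>
            H2 = {x \<in> L. \<phi>2 x \<in> S2}))) \<and>
     (CARD('n) = 2 \<longrightarrow>
       (let L = group_closure H3 in
         free_of_rank s L k \<and>
         (\<exists>\<phi>1 \<phi>2 S1 S2.
            quotient_map_F2 (s (1/2) ` L) L k \<phi>1 \<and> quotient_map_F2 L (s 2 ` L) k \<phi>2 \<and>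
            S1 \<subseteq> F2 k \<and> S2 \<subseteq> F2 k \<and> 0 \<in> S1 \<and>
            H1 = {x \<in> s (1/2) ` L. \<phi>1 x \<in> S1} \<and>
            H2 = {x \<in> L. \<phi>2 x \<in> S2}) \<and>
         H3 \<subseteq> L \<and> 0 \<in> H3 \<and> (\<exists>X\<subseteq>H3. Z_basis s X L) \<and>
         H2 + H3 = s 2 ` H1 + H3 \<and> s 2 ` H1 + H3 \<subseteq> H3))"
proof -
  have "form_space s B"
    using GRRS unfolding GRRS_def by (rule conjunct1)
  then obtain basis where "finite_dimensional_vector_space s basis"
    unfolding form_space_def by (elim conjE exE)
  then interpret complex_space s
    unfolding complex_space_def by (rule finite_dimensional_vector_space.axioms(1))
  obtain \<iota> c where
    \<iota>_add: "\<And>v w. \<iota> ((v + w) +o form_ker B) = \<iota> (v +o form_ker B) + \<iota> (w +o form_ker B)"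
    and \<iota>_scale: "\<And>a v. \<iota> (s a v +o form_ker B) = a *s \<iota> (v +o form_ker B)"
    and c: "c \<noteq> 0"
    and \<iota>_form: "\<And>v w. std_form (\<iota> (v +o form_ker B)) (\<iota> (w +o form_ker B)) = c * B v w"
    and \<iota>_roots: "\<iota> ` cl B R = (BC :: (complex ^ 'n) set)"
    using cl unfolding cl_iso_def by blast
  define q where "q v = \<iota> (v +o form_ker B)" for v
  \<comment> \<open>Absorbing \<open>c\<close> into the form makes \<open>q\<close> carry it to
    \<open>std_form\<close> exactly. Reflections and the kernel do not change, so \<open>R\<close>
    is kept and the required isomorphism is the identity with factor \<open>c\<close>.\<close>
  define B' where "B' v w = c * B v w" for v w
  have reflection_eq: "reflection s B' \<alpha> = reflection s B \<alpha>" for \<alpha>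
    using c by (simp add: reflection_def B'_def fun_eq_iff mult.left_commute)
  interpret BC_cover s B' R q
  proof
    show "q ` R = BC"
      using \<iota>_roots by (simp add: q_def cl_def image_image)
    show "reflection s B' \<alpha> ` R \<subseteq> R" if "\<alpha> \<in> R" "B' \<alpha> \<alpha> \<noteq> 0" for \<alpha>
      using GRRS that c unfolding GRRS_def reflection_eq by (simp add: B'_def)
  qed (simp_all add: q_def B'_def \<iota>_add \<iota>_scale \<iota>_form)
  obtain \<epsilon> where \<epsilon>: "\<And>i. q (\<epsilon> i) = std_basis i" "\<And>i. \<epsilon> i \<in> R"
    "\<And>i j. i \<noteq> j \<Longrightarrow> \<epsilon> i - \<epsilon> j \<in> R"
    using adapted_lift_exists by metis
  interpret finitely_generated_BC_lift s B' R q \<epsilon>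
    using GRRS finitely_generated unfolding GRRS_def by unfold_locales (simp_all add: \<epsilon>)
  have "form_ker B' = form_ker B"
    using c by (simp add: form_ker_def B'_def)
  then have k_eq: "k = dim K"
    using k form_ker_eq by simp
  have iso: "GRRS_iso s B R s B' R"
    unfolding GRRS_iso_def
    using c linear_id by (intro exI[of _ id] exI[of _ c]) (simp add: B'_def)
  have uminus: "uminus ` H = H" if "\<And>h. h \<in> H \<Longrightarrow> - h \<in> H" for H :: "'v set"
    using that by force
  show ?thesis
    unfolding k_eq Let_def
    apply (rule exI[of _ B'], rule exI[of _ R], rule exI[of _ \<epsilon>], rule exI[of _ H1],
        rule exI[of _ H2], rule exI[of _ H3], unfold form_ker_eq)
    apply (intro conjI)
                 apply (rule iso)
                apply (rule orthonormal_splitting_lift)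
               apply (rule root_decomposition)
              apply (rule shifts_subset_K)+
           apply (rule uminus, erule uminus_H1)
          apply (rule uminus, erule uminus_H2)
         apply (rule uminus, erule uminus_H3)
        apply (rule zero_in_H1)
       apply (rule zero_in_H3)
      apply (intro impI, erule case_one[OF _ refl])
     apply (intro impI, use case_at_least_two[OF _ refl] case_at_least_three in simp)
    apply (intro impI, use case_at_least_two[OF _ refl] case_two[OF _ refl] in simp)
    done
qed

end
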